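(* Let the source be $\mathsf{DSBS}(1-2\epsilon)$ with $0<\epsilon\le1/2$, and let $k,b,\gamma$ satisfy $(\log_2 b)/k\le4\epsilon(1-\epsilon)$. Then any interactive protocol solving ListCommonRandomness$^k_{\gamma,b}$ must communicate at least \[k\cdot\frac{\big[\sqrt{1-(\log_2 b)/k}-(1-2\epsilon)\big]^2}{8\epsilon(1-\epsilon)}-\frac32\log_2(1/\gamma)-O(1)\ \text{bits}.\] Consequently, whenever $(\log_2 b)/k\le4\epsilon(1-\epsilon)/(1+\Omega(1))$, any interactive protocol solving ListCommonRandomness$^k_{\gamma,b}$ must communicate at least $\Omega(\epsilon k)-O(\log(1/\gamma))$ bits.
   Context: $(X,Y)\sim\mathsf{DSBS}(\rho)$ means $X,Y$ uniform on $\{\pm1\}$ with $\mathbb E[XY]=\rho$. In ListCommonRandomness$^k_{\gamma,b}$, Alice and Bob receive $X^n$ and $Y^n$, where $(X_i,Y_i)$ are i.i.d. samples from a known source; they may communicate (interactively), after which Alice outputs an element $w_A$ and Bob outputs a list $L_B$ (over the same universe) such that (i) $\Pr[w_A\in L_B]\ge\gamma$; (ii) the min-entropy of $w_A$ is at least $k$; (iii) $|L_B|\le b$. The communication is the total number of bits exchanged. *)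

theory Defs
  imports "HOL-Probability.Probability"
begin

definition is_DSBS :: "real \<Rightarrow> (int \<times> int) pmf \<Rightarrow> bool" where
  "is_DSBS \<rho> \<mu> \<longleftrightarrow>
     map_pmf fst \<mu> = pmf_of_set {-1, 1} \<and>
     map_pmf snd \<mu> = pmf_of_set {-1, 1} \<and>
     measure_pmf.expectation \<mu> (\<lambda>(x, y). real_of_int (x * y)) = \<rho>"

text \<open>
  Interactive two-party protocols as binary trees. The type \<open>'a\<close> is everything Alice sees locally
  (her samples and her private coins), \<open>'b\<close> everything Bob sees locally. At an inner node the
  speaker sends one bit, a function of the speaker's local view and (through the position in the
  tree) of all bits exchanged before; on \<open>False\<close> the first subtree is entered, on \<open>True\<close> the second.
  At a leaf Alice outputs an element and Bob a list, each a function of the local view and of the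
  transcript leading to that leaf.
\<close>

datatype ('a, 'b, 'w) protocol =
    Output "'a \<Rightarrow> 'w" "'b \<Rightarrow> 'w list"
  | Alice_Sends "'a \<Rightarrow> bool" "('a, 'b, 'w) protocol" "('a, 'b, 'w) protocol"
  | Bob_Sends "'b \<Rightarrow> bool" "('a, 'b, 'w) protocol" "('a, 'b, 'w) protocol"

primrec transcript :: "('a, 'b, 'w) protocol \<Rightarrow> 'a \<Rightarrow> 'b \<Rightarrow> bool list" where
  "transcript (Output f g) u v = []"
| "transcript (Alice_Sends m P Q) u v =
     m u # (if m u then transcript Q u v else transcript P u v)"
| "transcript (Bob_Sends m P Q) u v =
     m v # (if m v then transcript Q u v else transcript P u v)"

primrec alice_output :: "('a, 'b, 'w) protocol \<Rightarrow> 'a \<Rightarrow> 'b \<Rightarrow> 'w" where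
  "alice_output (Output f g) u v = f u"
| "alice_output (Alice_Sends m P Q) u v =
     (if m u then alice_output Q u v else alice_output P u v)"
| "alice_output (Bob_Sends m P Q) u v =
     (if m v then alice_output Q u v else alice_output P u v)"

primrec bob_output :: "('a, 'b, 'w) protocol \<Rightarrow> 'a \<Rightarrow> 'b \<Rightarrow> 'w list" where
  "bob_output (Output f g) u v = g v"
| "bob_output (Alice_Sends m P Q) u v =
     (if m u then bob_output Q u v else bob_output P u v)"
| "bob_output (Bob_Sends m P Q) u v =
     (if m v then bob_output Q u v else bob_output P u v)"

text \<open>
  Joint law of the local views: \<open>n\<close> i.i.d. samples of the source \<open>\<mu>\<close>, the first components going to
  Alice and the second ones to Bob, together with private coins \<open>R\<close> of Alice and \<open>S\<close> of Bob, which
  are independent of each other and of the samples. Deterministic protocols are those that ignore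
  the coins.
\<close>

definition local_views ::
  "('x \<times> 'y) pmf \<Rightarrow> nat \<Rightarrow> 'r pmf \<Rightarrow> 's pmf \<Rightarrow> (('x list \<times> 'r) \<times> ('y list \<times> 's)) pmf" where
  "local_views \<mu> n R S =
     map_pmf (\<lambda>(xys, r, s). ((map fst xys, r), (map snd xys, s)))
       (pair_pmf (replicate_pmf n \<mu>) (pair_pmf R S))"

definition min_entropy :: "'w pmf \<Rightarrow> real" where
  "min_entropy p = - log 2 (SUP w. pmf p w)"

definition solves_list_common_randomness ::
  "real \<Rightarrow> real \<Rightarrow> nat \<Rightarrow> ('x \<times> 'y) pmf \<Rightarrow> nat \<Rightarrow> 'r pmf \<Rightarrow> 's pmf \<Rightarrow>
     ('x list \<times> 'r, 'y list \<times> 's, 'w) protocol \<Rightarrow> bool" where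
  "solves_list_common_randomness k \<gamma> b \<mu> n R S P \<longleftrightarrow>
     measure_pmf.prob (local_views \<mu> n R S)
       {(u, v). alice_output P u v \<in> set (bob_output P u v)} \<ge> \<gamma> \<and>
     min_entropy (map_pmf (\<lambda>(u, v). alice_output P u v) (local_views \<mu> n R S)) \<ge> k \<and>
     (\<forall>(u, v) \<in> set_pmf (local_views \<mu> n R S). length (bob_output P u v) \<le> b)"

text \<open>Worst-case number of exchanged bits over all executions of positive probability.\<close>

definition communication ::
  "('x \<times> 'y) pmf \<Rightarrow> nat \<Rightarrow> 'r pmf \<Rightarrow> 's pmf \<Rightarrow>
     ('x list \<times> 'r, 'y list \<times> 's, 'w) protocol \<Rightarrow> nat" where
  "communication \<mu> n R S P =
     Max ((\<lambda>(u, v). length (transcript P u v)) ` set_pmf (local_views \<mu> n R S))"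

text \<open>The maximum above is over a finite nonempty set, even if the coins have infinite support.\<close>

lemma length_transcript_bounded: "\<exists>d. \<forall>u v. length (transcript P u v) \<le> d"
proof (induction P)
  case (Output f g)
  then show ?case by simp
next
  case (Alice_Sends m P Q)
  then obtain d e where "\<forall>u v. length (transcript P u v) \<le> d"
    "\<forall>u v. length (transcript Q u v) \<le> e" by blast
  then show ?case by (intro exI[of _ "Suc (max d e)"]) (simp add: le_max_iff_disj)
next
  case (Bob_Sends m P Q)
  then obtain d e where "\<forall>u v. length (transcript P u v) \<le> d"
    "\<forall>u v. length (transcript Q u v) \<le> e" by blast
  then show ?case by (intro exI[of _ "Suc (max d e)"]) (simp add: le_max_iff_disj)
qed

lemma finite_communication_set:
  "finite ((\<lambda>(u, v). length (transcript P u v)) ` A)"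
proof -
  obtain d where "\<forall>u v. length (transcript P u v) \<le> d"
    using length_transcript_bounded by blast
  then have "(\<lambda>(u, v). length (transcript P u v)) ` A \<subseteq> {..d}" by auto
  then show ?thesis by (rule finite_subset) simp
qed

end

theory Submission
  imports Defs
begin

text \<open>
  Write \<open>\<rho> = 1 - 2 \<epsilon>\<close> and \<open>s\<^sup>2 = 1 - log\<^sub>2 b / k\<close>. Two-function hypercontractivity bounds the
  probability of a rectangle \<open>A \<times> B\<close> of local views by \<open>Pr[A]\<^sup>1\<^sup>/\<^sup>p Pr[B]\<^sup>1\<^sup>/\<^sup>q\<close> whenever
  \<open>(p - 1) (q - 1) = \<rho>\<^sup>2\<close>. Without communication, summing over the possible outputs \<open>w\<close> of Alice,
  using \<open>Pr[w] \<le> 2\<^sup>-\<^sup>k\<close>, the list size \<open>b\<close> and Hoelder's inequality, and optimising over \<open>p\<close> and \<open>q\<close>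
  gives agreement probability at most \<open>2\<^sup>-\<^sup>k\<^sup>h\<close> with \<open>h = (s - \<rho>)\<^sup>2 / (1 - \<rho>\<^sup>2)\<close>. A protocol with \<open>c\<close>
  bits splits the views into \<open>2\<^sup>c\<close> rectangles, one for each transcript; on Alice's side and on Bob's
  side this loses a factor of about \<open>2\<^sup>c\<close> each, which is where the factor \<open>1/2\<close> in the bound on \<open>c\<close>
  comes from. For the linear bound the additive constant is absorbed by \<open>c \<ge> 1\<close>, while \<open>c = 0\<close> is
  covered by the constant-free bound.
\<close>

section \<open>Hypercontractivity on two points\<close>

lemma powr_mult_le_weighted_sum:
  fixes a b \<theta> :: real
  assumes "0 \<le> \<theta>" "\<theta> \<le> 1" "0 \<le> a" "0 \<le> b"
  shows "a powr (1 - \<theta>) * b powr \<theta> \<le> (1 - \<theta>) * a + \<theta> * b"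
proof (cases "a = 0 \<or> b = 0")
  case True
  then show ?thesis using assms by auto
next
  case False
  then show ?thesis using assms by (intro Youngs_inequality_0) auto
qed

text \<open>Hoelder's inequality with upper bounds in place of the sums: after dividing by
  \<open>F\<close> and \<open>G\<close>, weighted AM-GM applies to each term.\<close>

lemma sum_powr_mult_powr_le:
  fixes \<alpha> \<beta> :: "'i \<Rightarrow> real"
  assumes \<theta>: "0 \<le> \<theta>" "\<theta> \<le> 1"
    and nonneg: "\<And>i. i \<in> I \<Longrightarrow> 0 \<le> \<alpha> i" "\<And>i. i \<in> I \<Longrightarrow> 0 \<le> \<beta> i"
    and F: "0 < F" "sum \<alpha> I \<le> F" and G: "0 < G" "sum \<beta> I \<le> G"
  shows "(\<Sum>i\<in>I. \<alpha> i powr (1 - \<theta>) * \<beta> i powr \<theta>) \<le> F powr (1 - \<theta>) * G powr \<theta>"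
proof -
  let ?c = "F powr (1 - \<theta>) * G powr \<theta>"
  have "(\<Sum>i\<in>I. \<alpha> i powr (1 - \<theta>) * \<beta> i powr \<theta>)
      \<le> (\<Sum>i\<in>I. ?c * ((1 - \<theta>) * (\<alpha> i / F) + \<theta> * (\<beta> i / G)))"
  proof (rule sum_mono)
    fix i assume i: "i \<in> I"
    have "\<alpha> i powr (1 - \<theta>) * \<beta> i powr \<theta> = ?c * ((\<alpha> i / F) powr (1 - \<theta>) * (\<beta> i / G) powr \<theta>)"
      using F G nonneg[OF i] by (simp add: powr_divide)
    also have "\<dots> \<le> ?c * ((1 - \<theta>) * (\<alpha> i / F) + \<theta> * (\<beta> i / G))"
      using nonneg[OF i] F G \<theta> by (intro mult_left_mono powr_mult_le_weighted_sum) auto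
    finally show "\<alpha> i powr (1 - \<theta>) * \<beta> i powr \<theta> \<le> \<dots>" .
  qed
  also have "\<dots> = ?c * ((1 - \<theta>) * (sum \<alpha> I / F) + \<theta> * (sum \<beta> I / G))"
    by (simp add: sum_distrib_left sum.distrib sum_divide_distrib algebra_simps)
  also have "\<dots> \<le> ?c * ((1 - \<theta>) * 1 + \<theta> * 1)"
    using \<theta> F G by (intro mult_left_mono add_mono) auto
  finally show ?thesis by simp
qed

text \<open>The excess \<open>x + y - 1\<close> of the exponents over 1 is taken out of
  \<open>\<alpha> i\<close> through the bound \<open>m\<close>, and Hoelder handles the rest. Later
  \<open>\<alpha> i\<close> is the probability of Alice's side of a rectangle, and \<open>m\<close>
  carries the min-entropy.\<close>

lemma sum_powr_mult_powr_le_bounded: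
  fixes \<alpha> \<beta> :: "'i \<Rightarrow> real"
  assumes xy: "0 \<le> y" "y \<le> 1" "1 \<le> x + y"
    and nonneg: "\<And>i. i \<in> I \<Longrightarrow> 0 \<le> \<alpha> i" "\<And>i. i \<in> I \<Longrightarrow> 0 \<le> \<beta> i"
    and m: "\<And>i. i \<in> I \<Longrightarrow> \<alpha> i \<le> m"
    and F: "0 < F" "sum \<alpha> I \<le> F" and G: "0 < G" "sum \<beta> I \<le> G"
  shows "(\<Sum>i\<in>I. \<alpha> i powr x * \<beta> i powr y) \<le> m powr (x + y - 1) * (F powr (1 - y) * G powr y)"
proof -
  have "(\<Sum>i\<in>I. \<alpha> i powr x * \<beta> i powr y)
      \<le> (\<Sum>i\<in>I. m powr (x + y - 1) * (\<alpha> i powr (1 - y) * \<beta> i powr y))"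
  proof (rule sum_mono)
    fix i assume i: "i \<in> I"
    have "\<alpha> i powr x = \<alpha> i powr (x + y - 1) * \<alpha> i powr (1 - y)"
      by (simp flip: powr_add)
    also have "\<dots> \<le> m powr (x + y - 1) * \<alpha> i powr (1 - y)"
      using xy nonneg[OF i] m[OF i] by (intro mult_right_mono powr_mono2) auto
    finally show "\<alpha> i powr x * \<beta> i powr y \<le> m powr (x + y - 1) * (\<alpha> i powr (1 - y) * \<beta> i powr y)"
      by (simp add: mult_right_mono flip: mult.assoc)
  qed
  also have "\<dots> = m powr (x + y - 1) * (\<Sum>i\<in>I. \<alpha> i powr (1 - y) * \<beta> i powr y)"
    by (simp add: sum_distrib_left)
  also have "\<dots> \<le> m powr (x + y - 1) * (F powr (1 - y) * G powr y)"
    using assms by (intro mult_left_mono sum_powr_mult_powr_le) auto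
  finally show ?thesis .
qed

text \<open>\<open>(E \<bar>1 + a X\<bar>\<^sup>p)\<^sup>1\<^sup>/\<^sup>p\<close> for a uniform sign \<open>X\<close> and \<open>\<bar>a\<bar> \<le> 1\<close>.\<close>

definition two_point_norm :: "real \<Rightarrow> real \<Rightarrow> real" where
  "two_point_norm p a = (((1 + a) powr p + (1 - a) powr p) / 2) powr (1 / p)"

section \<open>The Bonami--Beckner inequality by comparing binomial series\<close>

text \<open>In the average of the binomial series at \<open>y\<close> and \<open>-y\<close> the odd
  terms cancel.\<close>

lemma even_binomial_series:
  fixes y :: real
  assumes "\<bar>y\<bar> < 1"
  shows "(\<lambda>j. (p gchoose (2 * j)) * y ^ (2 * j)) sums (((1 + y) powr p + (1 - y) powr p) / 2)"
proof -
  have "(\<lambda>n. ((p gchoose n) * y ^ n + (p gchoose n) * (- y) ^ n) / 2)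
      sums (((1 + y) powr p + (1 + - y) powr p) / 2)"
    using assms by (intro sums_divide sums_add gen_binomial_real) auto
  moreover have "((p gchoose n) * y ^ n + (p gchoose n) * (- y) ^ n) / 2
      = (if even n then (p gchoose n) * y ^ n else 0)" for n
    by simp
  ultimately have "(\<lambda>n. if even n then (p gchoose n) * y ^ n else 0)
      sums (((1 + y) powr p + (1 - y) powr p) / 2)"
    by (simp only: add_uminus_conv_diff)
  then have "(\<lambda>j. if even (2 * j) then (p gchoose (2 * j)) * y ^ (2 * j) else 0)
      sums (((1 + y) powr p + (1 - y) powr p) / 2)"
    by (subst sums_mono_reindex) (auto simp: strict_mono_def elim!: evenE)
  then show ?thesis by simp
qed

lemma gbinomial_add_2:
  fixes a :: real
  shows "a gchoose (n + 2) = (a gchoose n) * ((a - real n) * (a - real n - 1) / ((real n + 1) * (real n + 2)))"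
  by (simp add: gbinomial_prod_rev numeral_2_eq_2 prod.atLeast0_lessThan_Suc field_simps)

text \<open>Induction in steps of two. At index 2 the relation between \<open>r\<close>,
  \<open>p\<close> and \<open>q\<close> gives equality; each step multiplies the two sides by
  \<open>cq * r\<^sup>2\<close> and \<open>cp\<close>, where \<open>0 \<le> cq\<close> and
  \<open>cq \<le> cp\<close> because \<open>p \<le> q\<close> and \<open>q \<le> 2\<close>.\<close>

lemma even_gbinomial_le:
  fixes p q r :: real
  assumes "1 \<le> p" "p \<le> q" "q \<le> 2" "0 \<le> r" "r \<le> 1" "r\<^sup>2 * (q - 1) = p - 1"
  shows "0 \<le> q gchoose (2 * Suc j) \<and>
    p / q * ((q gchoose (2 * Suc j)) * r ^ (2 * Suc j)) \<le> p gchoose (2 * Suc j)"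
proof (induction j)
  case 0
  have "p / q * (q * (q - 1) / 2 * r\<^sup>2) = p / 2 * (r\<^sup>2 * (q - 1))"
    using assms(1,2) by (simp add: field_simps)
  also have "\<dots> = p * (p - 1) / 2" using assms(6) by simp
  finally have "p / q * ((q gchoose 2) * r\<^sup>2) = p gchoose 2"
    by (simp add: gbinomial_prod_rev numeral_2_eq_2 del: mult_cancel_left)
  moreover have "0 \<le> q gchoose 2" using assms
    by (simp add: gbinomial_prod_rev numeral_2_eq_2)
  ultimately show ?case by simp
next
  case (Suc j)
  let ?n = "2 * Suc j"
  define D where "D = (real ?n + 1) * (real ?n + 2)"
  define cq where "cq = (q - ?n) * (q - ?n - 1) / D"
  define cp where "cp = (p - ?n) * (p - ?n - 1) / D"
  have D: "D > 0" by (simp add: D_def)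
  have n: "real ?n \<ge> 2" by simp
  \<comment> \<open>In this form all factors are nonnegative, as \<open>?n\<close> is at least 2,
    and decrease in the exponent.\<close>
  have cq: "cq = (?n - q) * (?n + 1 - q) / D" and cp: "cp = (?n - p) * (?n + 1 - p) / D"
    by (simp_all add: cq_def cp_def algebra_simps)
  have "0 \<le> cq" unfolding cq using n D assms(3) by (intro divide_nonneg_pos mult_nonneg_nonneg) linarith+
  moreover have "cq \<le> cp" unfolding cq cp using n D assms(2,3)
    by (intro divide_right_mono mult_mono) linarith+
  ultimately have c: "0 \<le> cq" "cq \<le> cp" .
  have eq: "q gchoose (2 * Suc (Suc j)) = (q gchoose ?n) * cq"
    "p gchoose (2 * Suc (Suc j)) = (p gchoose ?n) * cp"
    unfolding cq_def cp_def D_def gbinomial_add_2[symmetric] by simp_all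
  have r2: "0 \<le> r\<^sup>2" "r\<^sup>2 \<le> 1" using assms by (auto simp: power_le_one)
  let ?A = "p / q * ((q gchoose ?n) * r ^ ?n)"
  have A0: "0 \<le> ?A" using Suc assms by simp
  have "p / q * ((q gchoose (2 * Suc (Suc j))) * r ^ (2 * Suc (Suc j))) = ?A * (cq * r\<^sup>2)"
    unfolding eq by (simp add: power2_eq_square)
  also have "\<dots> \<le> (p gchoose ?n) * (cp * 1)"
    using Suc A0 c r2 by (intro mult_mono) auto
  finally show ?case using Suc c unfolding eq by simp
qed

text \<open>The Bonami--Beckner inequality for exponents in \<open>[1, 2]\<close>: there all even binomial
  coefficients are nonnegative, and after Bernoulli's inequality the two power series can be
  compared term by term.\<close>

lemma bonami_two_point_interior:
  fixes p q r y :: real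
  assumes pqr: "1 \<le> p" "p \<le> q" "q \<le> 2" "0 \<le> r" "r \<le> 1" "r\<^sup>2 * (q - 1) = p - 1"
    and y: "\<bar>y\<bar> < 1"
  shows "two_point_norm q (r * y) \<le> two_point_norm p y"
proof -
  define A where "A = ((1 + r * y) powr q + (1 - r * y) powr q) / 2"
  define B where "B = ((1 + y) powr p + (1 - y) powr p) / 2"
  have ry: "\<bar>r * y\<bar> < 1"
    using mult_right_mono[of r 1 "\<bar>y\<bar>"] pqr y by (simp add: abs_mult)
  have sA: "(\<lambda>j. (q gchoose (2 * Suc j)) * (r * y) ^ (2 * Suc j)) sums (A - 1)"
    using even_binomial_series[OF ry, of q] unfolding A_def by (subst sums_Suc_iff) simp
  have sB: "(\<lambda>j. (p gchoose (2 * Suc j)) * y ^ (2 * Suc j)) sums (B - 1)"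
    using even_binomial_series[OF y, of p] unfolding B_def by (subst sums_Suc_iff) simp
  have yy: "0 \<le> (z::real) ^ (2 * Suc j)" for z j by (intro zero_le_even_power) simp
  have A1: "A - 1 \<ge> 0"
    using even_gbinomial_le[OF pqr] yy by (intro sums_le[OF _ sums_zero sA]) simp
  have AB: "p / q * (A - 1) \<le> B - 1"
  proof (rule sums_le[OF _ sums_mult[OF sA] sB])
    fix j
    have "p / q * ((q gchoose (2 * Suc j)) * r ^ (2 * Suc j)) * y ^ (2 * Suc j)
        \<le> (p gchoose (2 * Suc j)) * y ^ (2 * Suc j)"
      using even_gbinomial_le[OF pqr] yy by (intro mult_right_mono) auto
    then show "p / q * ((q gchoose (2 * Suc j)) * (r * y) ^ (2 * Suc j))
        \<le> (p gchoose (2 * Suc j)) * y ^ (2 * Suc j)"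
      by (simp add: power_mult_distrib mult_ac)
  qed
  \<comment> \<open>Bernoulli's inequality, as weighted AM-GM of \<open>A\<close> and 1 with weights
    \<open>p / q\<close> and \<open>1 - p / q\<close>.\<close>
  have "A powr (p / q) = A powr (1 - (1 - p / q)) * 1 powr (1 - p / q)" by simp
  also have "\<dots> \<le> p / q * A + (1 - p / q)"
    using powr_mult_le_weighted_sum[of "1 - p / q" A 1] pqr A1 by (simp add: divide_simps)
  also have "\<dots> = p / q * (A - 1) + 1" by (simp add: right_diff_distrib)
  also have "\<dots> \<le> B" using AB by simp
  finally have "(A powr (p / q)) powr (1 / p) \<le> B powr (1 / p)"
    using pqr by (intro powr_mono2) auto
  then show ?thesis using pqr by (simp add: powr_powr two_point_norm_def A_def B_def)
qed

text \<open>Continuity up to \<open>\<bar>y\<bar> = 1\<close>: there a base of \<open>powr\<close>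
  becomes 0, which is harmless for nonnegative bases and positive exponents.\<close>

lemma tendsto_two_point_norm:
  assumes "1 \<le> p" "\<bar>y\<bar> \<le> 1" "\<And>n::nat. \<bar>f n\<bar> \<le> 1" "f \<longlonglongrightarrow> y"
  shows "(\<lambda>n. two_point_norm p (f n)) \<longlonglongrightarrow> two_point_norm p y"
  unfolding two_point_norm_def
proof (intro tendsto_powr' tendsto_divide tendsto_add tendsto_diff tendsto_const assms disjI2 conjI)
  show "\<forall>\<^sub>F n in sequentially. 0 \<le> 1 + f n" "\<forall>\<^sub>F n in sequentially. 0 \<le> 1 - f n"
    using assms(3) by (auto intro!: always_eventually simp: abs_le_iff) (smt (verit))+
qed (use assms in auto)

text \<open>The power series need \<open>\<bar>y\<bar> < 1\<close>; the endpoints follow by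
  approaching \<open>y\<close> from inside along its own multiples.\<close>

lemma bonami_two_point:
  fixes p q r y :: real
  assumes pqr: "1 \<le> p" "p \<le> q" "q \<le> 2" "0 \<le> r" "r \<le> 1" "r\<^sup>2 * (q - 1) = p - 1"
    and y: "\<bar>y\<bar> \<le> 1"
  shows "two_point_norm q (r * y) \<le> two_point_norm p y"
proof -
  define f where "f n = (1 - 1 / real (Suc n)) * y" for n
  have t: "0 \<le> 1 - 1 / real (Suc n)" "1 - 1 / real (Suc n) < 1" for n by simp_all
  have f1: "\<bar>f n\<bar> < 1" for n
    using t[of n] y unfolding f_def abs_mult by (smt (verit) mult_left_le)
  have f: "f \<longlonglongrightarrow> (1 - 0) * y" unfolding f_def
    by (intro tendsto_mult tendsto_diff tendsto_const LIMSEQ_Suc[OF lim_1_over_n])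
  have rz: "\<bar>r * z\<bar> \<le> 1" if "\<bar>z\<bar> \<le> 1" for z
    using pqr that by (simp add: abs_mult mult_le_one)
  have "(\<lambda>n. two_point_norm q (r * f n)) \<longlonglongrightarrow> two_point_norm q (r * y)"
    using pqr y f f1 rz
    by (intro tendsto_two_point_norm) (auto intro!: tendsto_eq_intros intro: less_imp_le[OF f1])
  moreover have "(\<lambda>n. two_point_norm p (f n)) \<longlonglongrightarrow> two_point_norm p y"
    using pqr y f f1 by (intro tendsto_two_point_norm) (auto intro: less_imp_le)
  ultimately show ?thesis
    using bonami_two_point_interior[OF pqr f1] by (intro LIMSEQ_le) auto
qed

lemma two_point_norm_2: "two_point_norm 2 a = sqrt (1 + a\<^sup>2)" if "\<bar>a\<bar> \<le> 1"
proof -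
  have "((1 + a) powr 2 + (1 - a) powr 2) / 2 = 1 + a\<^sup>2"
    using that by (simp add: powr_numeral power2_eq_square field_simps)
  then show ?thesis by (simp add: two_point_norm_def powr_half_sqrt)
qed

section \<open>Two functions on two points\<close>

text \<open>For a uniform sign \<open>X\<close> the left side is
  \<open>E[(1 + a X)(1 + b X)]\<close>, and \<open>q / (q - 1)\<close> and \<open>q\<close> are
  conjugate exponents.\<close>

lemma two_point_holder:
  fixes a b :: real
  assumes q: "1 < q" and ab: "\<bar>a\<bar> \<le> 1" "\<bar>b\<bar> \<le> 1"
  shows "1 + a * b \<le> two_point_norm (q / (q - 1)) a * two_point_norm q b"
proof -
  define q' where "q' = q / (q - 1)"
  define f where "f s = (if s then 1 + a else 1 - a)" for s
  define g where "g s = (if s then 1 + b else 1 - b)" for s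
  have fg: "0 \<le> f s" "0 \<le> g s" for s using ab by (auto simp: f_def g_def)
  have q': "1 < q'" "1 / q' = 1 - 1 / q" using q by (auto simp: q'_def field_simps)
  have qq: "q' * (1 - 1 / q) = 1" using q'(1) by (simp add: q'(2)[symmetric])
  have pos: "0 < ((1 + z) powr t + (1 - z) powr t) / 2" if "\<bar>z\<bar> \<le> 1" for z t :: real
    using that by (cases "z = 1") (auto intro!: add_nonneg_pos)
  have S: "sum h UNIV = h True + h False" for h :: "bool \<Rightarrow> real" by (simp add: UNIV_bool)
  have "(\<Sum>s\<in>UNIV. (f s powr q' / 2) powr (1 - 1 / q) * (g s powr q / 2) powr (1 / q))
      \<le> (((1 + a) powr q' + (1 - a) powr q') / 2) powr (1 - 1 / q)
        * (((1 + b) powr q + (1 - b) powr q) / 2) powr (1 / q)"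
    by (rule sum_powr_mult_powr_le) (use q ab pos in \<open>auto simp: S f_def g_def add_divide_distrib\<close>)
  moreover have "(f s powr q' / 2) powr (1 - 1 / q) * (g s powr q / 2) powr (1 / q) = f s * g s / 2" for s
  proof -
    have h1: "(1/2::real) powr (1 - 1 / q) * (1/2) powr (1 / q) = 1 / 2" by (simp flip: powr_add)
    have h2: "(f s powr q' * (1/2)) powr (1 - 1 / q) = f s * (1/2) powr (1 - 1 / q)"
      using fg qq by (subst powr_mult) (auto simp: powr_powr)
    have h3: "(g s powr q * (1/2)) powr (1 / q) = g s * (1/2) powr (1 / q)"
      using fg q by (subst powr_mult) (auto simp: powr_powr)
    have "(f s powr q' / 2) powr (1 - 1 / q) * (g s powr q / 2) powr (1 / q)
        = (f s * (1/2) powr (1 - 1 / q)) * (g s * (1/2) powr (1 / q))"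
      unfolding h2[symmetric] h3[symmetric] by simp
    also have "\<dots> = f s * g s * ((1/2) powr (1 - 1 / q) * (1/2) powr (1 / q))"
      by (simp only: mult_ac)
    finally show ?thesis unfolding h1 by simp
  qed
  ultimately have "f True * g True / 2 + f False * g False / 2
     \<le> two_point_norm q' a * two_point_norm q b"
    by (simp add: S two_point_norm_def q')
  moreover have "f True * g True / 2 + f False * g False / 2 = 1 + a * b"
    by (simp add: f_def g_def field_simps)
  ultimately show ?thesis by (simp add: q'_def)
qed

text \<open>For a DSBS pair the left side is \<open>E[(1 + a X)(1 + b Y)]\<close>. If
  \<open>q \<le> 2\<close>, split \<open>\<rho> = sqrt (p - 1) * sqrt (q - 1)\<close>, apply
  Cauchy--Schwarz and pass from each 2-norm by Bonami--Beckner. If \<open>q > 2\<close>, its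
  conjugate exponent is below 2: Hoelder, then Bonami--Beckner with noise \<open>\<rho>\<close> on
  the first function only.\<close>

lemma two_function_two_point:
  fixes p q \<rho> a b :: real
  assumes p: "1 \<le> p" "p \<le> 2" and q: "1 \<le> q" and \<rho>: "0 \<le> \<rho>" "\<rho> \<le> 1" "(p - 1) * (q - 1) = \<rho>\<^sup>2"
    and ab: "\<bar>a\<bar> \<le> 1" "\<bar>b\<bar> \<le> 1"
  shows "1 + \<rho> * a * b \<le> two_point_norm p a * two_point_norm q b"
proof (cases "q \<le> 2")
  case True
  define x where "x = sqrt (p - 1) * a"
  define y where "y = sqrt (q - 1) * b"
  have sq: "sqrt (p - 1) \<le> 1" "sqrt (q - 1) \<le> 1" using p q True by auto
  have x: "two_point_norm 2 x \<le> two_point_norm p a" unfolding x_def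
    using p ab sq by (intro bonami_two_point) auto
  have y: "two_point_norm 2 y \<le> two_point_norm q b" unfolding y_def
    using q True ab sq by (intro bonami_two_point) auto
  have xy1: "\<bar>x\<bar> \<le> 1" "\<bar>y\<bar> \<le> 1"
    unfolding x_def y_def abs_mult using sq ab p q by (auto intro!: mult_le_one)
  have "\<rho> = sqrt (p - 1) * sqrt (q - 1)"
    using \<rho> by (metis real_sqrt_mult real_sqrt_unique)
  then have "1 + \<rho> * a * b = 1 + x * y" by (simp add: x_def y_def)
  also have "\<dots> \<le> sqrt ((1 + x\<^sup>2) * (1 + y\<^sup>2))"
  proof (rule real_le_rsqrt)
    have "0 \<le> (x - y)\<^sup>2" by simp
    then show "(1 + x * y)\<^sup>2 \<le> (1 + x\<^sup>2) * (1 + y\<^sup>2)"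
      by (simp add: power2_eq_square algebra_simps)
  qed
  also have "\<dots> = two_point_norm 2 x * two_point_norm 2 y"
    using xy1 by (simp add: two_point_norm_2 real_sqrt_mult)
  also have "\<dots> \<le> two_point_norm p a * two_point_norm q b"
    using x y by (intro mult_mono) (auto simp: two_point_norm_def)
  finally show ?thesis .
next
  case False
  define q' where "q' = q / (q - 1)"
  have q1: "q' - 1 = 1 / (q - 1)" using False by (simp add: q'_def field_simps)
  have r: "\<rho>\<^sup>2 * (q' - 1) = p - 1" using False \<rho>(3) by (simp add: q1 field_simps)
  have "\<rho>\<^sup>2 \<le> 1" using \<rho> by (simp add: power_le_one)
  moreover have "0 \<le> q' - 1" using False by (simp add: q1)
  ultimately have "p - 1 \<le> q' - 1" unfolding r[symmetric] by (simp add: mult_left_le_one_le)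
  moreover have "q' \<le> 2" using False by (simp add: q'_def field_simps)
  ultimately have B: "two_point_norm q' (\<rho> * a) \<le> two_point_norm p a"
    using p \<rho> ab r by (intro bonami_two_point) auto
  have "1 + \<rho> * a * b \<le> two_point_norm q' (\<rho> * a) * two_point_norm q b"
    unfolding q'_def using False \<rho> ab by (intro two_point_holder) (auto simp: abs_mult mult_le_one)
  also have "\<dots> \<le> two_point_norm p a * two_point_norm q b"
    using B by (intro mult_right_mono) (auto simp: two_point_norm_def)
  finally show ?thesis .
qed

section \<open>Hypercontractive pairs of random variables\<close>

lemma powr_in_unit: "x powr p \<in> {0..1}" if "x \<in> {0..1}" "0 \<le> p" for x p :: real
  using that powr_mono2[of p x 1] by auto

lemma integrable_pmf_unit: "integrable (measure_pmf M) f" if "\<And>x. f x \<in> {0..1::real}"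
  using that by (intro measure_pmf.integrable_const_bound[where B = 1]) auto

lemma integral_pmf_unit: "measure_pmf.expectation M f \<in> {0..1}" if "\<And>x. f x \<in> {0..1::real}"
  using that integrable_pmf_unit[of f M, OF that] measure_pmf.integral_le_const[of M f 1]
  by (auto intro!: integral_nonneg_AE)

text \<open>Fubini via nonnegative integrals; values in \<open>{0..1}\<close> keep every integral
  finite, so the identity transfers back to the reals.\<close>

lemma integral_pair_pmf_unit:
  assumes f: "\<And>z. f z \<in> {0..1::real}"
  shows "measure_pmf.expectation (pair_pmf A B) f = (\<integral>a. \<integral>b. f (a, b) \<partial>B \<partial>A)"
proof -
  have i: "(\<integral>b. f (a, b) \<partial>B) \<in> {0..1}" for a
    using f by (rule integral_pmf_unit)
  have "ennreal (measure_pmf.expectation (pair_pmf A B) f) = (\<integral>\<^sup>+z. ennreal (f z) \<partial>pair_pmf A B)"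
    using f by (intro nn_integral_eq_integral[symmetric] integrable_pmf_unit) auto
  also have "\<dots> = (\<integral>\<^sup>+a. \<integral>\<^sup>+b. ennreal (f (a, b)) \<partial>B \<partial>A)"
    by (rule nn_integral_pair_pmf')
  also have "\<dots> = (\<integral>\<^sup>+a. ennreal (\<integral>b. f (a, b) \<partial>B) \<partial>A)"
    using f by (intro nn_integral_cong nn_integral_eq_integral integrable_pmf_unit) auto
  also have "\<dots> = ennreal (\<integral>a. \<integral>b. f (a, b) \<partial>B \<partial>A)"
    using i by (intro nn_integral_eq_integral integrable_pmf_unit) auto
  finally show ?thesis
    using integral_pmf_unit[of f "pair_pmf A B", OF f]
      integral_pmf_unit[of "\<lambda>a. \<integral>b. f (a, b) \<partial>B" A, OF i] by (simp add: ennreal_inj)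
qed

section \<open>Hypercontractivity and its tensorization\<close>

text \<open>Test functions into \<open>{0..1}\<close> are always integrable, include indicators, and
  are stable under the partial norms that tensorization takes.\<close>

definition hypercontractive :: "real \<Rightarrow> real \<Rightarrow> ('a \<times> 'b) pmf \<Rightarrow> bool" where
  "hypercontractive p q M \<longleftrightarrow>
     (\<forall>f g. (\<forall>x. f x \<in> {0..1}) \<and> (\<forall>y. g y \<in> {0..1}) \<longrightarrow>
        measure_pmf.expectation M (\<lambda>z. f (fst z) * g (snd z))
        \<le> measure_pmf.expectation M (\<lambda>z. f (fst z) powr p) powr (1 / p)
          * measure_pmf.expectation M (\<lambda>z. g (snd z) powr q) powr (1 / q))"

lemma hypercontractiveD:
  assumes "hypercontractive p q M" "\<And>x. f x \<in> {0..1}" "\<And>y. g y \<in> {0..1}"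
  shows "measure_pmf.expectation M (\<lambda>z. f (fst z) * g (snd z))
        \<le> measure_pmf.expectation M (\<lambda>z. f (fst z) powr p) powr (1 / p)
          * measure_pmf.expectation M (\<lambda>z. g (snd z) powr q) powr (1 / q)"
  using assms unfolding hypercontractive_def by blast

lemma hypercontractive_map_prod:
  fixes \<phi> :: "'a \<Rightarrow> 'c" and \<psi> :: "'b \<Rightarrow> 'd"
  assumes "hypercontractive p q M"
  shows "hypercontractive p q (map_pmf (map_prod \<phi> \<psi>) M)"
  unfolding hypercontractive_def
proof safe
  fix f :: "'c \<Rightarrow> real" and g :: "'d \<Rightarrow> real"
  assume "\<forall>x. f x \<in> {0..1}" "\<forall>y. g y \<in> {0..1}"
  then show "measure_pmf.expectation (map_pmf (map_prod \<phi> \<psi>) M) (\<lambda>z. f (fst z) * g (snd z))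
        \<le> measure_pmf.expectation (map_pmf (map_prod \<phi> \<psi>) M) (\<lambda>z. f (fst z) powr p) powr (1 / p)
          * measure_pmf.expectation (map_pmf (map_prod \<phi> \<psi>) M) (\<lambda>z. g (snd z) powr q) powr (1 / q)"
    using hypercontractiveD[OF assms, of "\<lambda>x. f (\<phi> x)" "\<lambda>y. g (\<psi> y)"] by simp
qed

text \<open>For fixed \<open>z\<close> the inequality for \<open>N\<close> bounds the inner integral
  by a product of partial norms; these are again test functions, to which the inequality for
  \<open>M\<close> applies.\<close>

lemma hypercontractive_pair:
  assumes "1 \<le> p" "1 \<le> q" "hypercontractive p q M" "hypercontractive p q N"
  shows "hypercontractive p q
     (map_pmf (\<lambda>(z, z'). ((fst z, fst z'), (snd z, snd z'))) (pair_pmf M N))"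
  unfolding hypercontractive_def
proof safe
  fix f :: "'a \<times> 'c \<Rightarrow> real" and g :: "'b \<times> 'd \<Rightarrow> real"
  assume "\<forall>x. f x \<in> {0..1}" "\<forall>y. g y \<in> {0..1}"
  then have fg: "f x \<in> {0..1}" "g y \<in> {0..1}" for x y by blast+
  let ?MN = "map_pmf (\<lambda>(z, z'). ((fst z, fst z'), (snd z, snd z'))) (pair_pmf M N)"
  define F where "F x = (\<integral>z'. f (x, fst z') powr p \<partial>N)" for x
  define G where "G y = (\<integral>z'. g (y, snd z') powr q \<partial>N)" for y
  have fp: "f x powr p \<in> {0..1}" and gq: "g y powr q \<in> {0..1}" for x y
    using fg assms powr_in_unit by auto
  have F: "F x \<in> {0..1}" and G: "G y \<in> {0..1}" for x y
    unfolding F_def G_def by (intro integral_pmf_unit fp gq)+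
  have F': "F x powr (1 / p) \<in> {0..1}" and G': "G y powr (1 / q) \<in> {0..1}" for x y
    using powr_in_unit[OF F] powr_in_unit[OF G] assms by auto
  have prod: "a * b \<in> {0..1}" if "a \<in> {0..1}" "b \<in> {0..1}" for a b :: real
    using that by (auto simp: mult_le_one)
  have intF: "(\<integral>z. f (fst z) powr p \<partial>?MN) = (\<integral>z. (F (fst z) powr (1 / p)) powr p \<partial>M)"
    using fp F assms(1) by (simp add: split_def integral_pair_pmf_unit F_def powr_powr)
  have intG: "(\<integral>z. g (snd z) powr q \<partial>?MN) = (\<integral>z. (G (snd z) powr (1 / q)) powr q \<partial>M)"
    using gq G assms(2) by (simp add: split_def integral_pair_pmf_unit G_def powr_powr)
  have "(\<integral>z. f (fst z) * g (snd z) \<partial>?MN)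
      = (\<integral>z. \<integral>z'. f (fst z, fst z') * g (snd z, snd z') \<partial>N \<partial>M)"
    using prod[OF fg] by (simp add: split_def integral_pair_pmf_unit)
  also have "\<dots> \<le> (\<integral>z. F (fst z) powr (1 / p) * G (snd z) powr (1 / q) \<partial>M)"
  proof (rule integral_mono)
    show "integrable M (\<lambda>z. \<integral>z'. f (fst z, fst z') * g (snd z, snd z') \<partial>N)"
      using prod[OF fg] by (intro integrable_pmf_unit integral_pmf_unit) 
    show "integrable M (\<lambda>z. F (fst z) powr (1 / p) * G (snd z) powr (1 / q))"
      using prod[OF F' G'] by (intro integrable_pmf_unit)
    show "(\<integral>z'. f (fst z, fst z') * g (snd z, snd z') \<partial>N)
        \<le> F (fst z) powr (1 / p) * G (snd z) powr (1 / q)" for z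
      unfolding F_def G_def
      using hypercontractiveD[OF assms(4), of "\<lambda>x. f (fst z, x)" "\<lambda>y. g (snd z, y)"] fg by blast
  qed
  also have "\<dots> \<le> (\<integral>z. (F (fst z) powr (1 / p)) powr p \<partial>M) powr (1 / p)
      * (\<integral>z. (G (snd z) powr (1 / q)) powr q \<partial>M) powr (1 / q)"
    using F' G' by (intro hypercontractiveD[OF assms(3)])
  finally show "(\<integral>z. f (fst z) * g (snd z) \<partial>?MN)
      \<le> (\<integral>z. f (fst z) powr p \<partial>?MN) powr (1 / p) * (\<integral>z. g (snd z) powr q \<partial>?MN) powr (1 / q)"
    unfolding intF intG .
qed

text \<open>Monotonicity of power means: weighted AM-GM of 1 and \<open>f x powr p / m\<close>,
  integrated. If \<open>m = 0\<close>, then \<open>f\<close> vanishes almost surely.\<close>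

lemma expectation_le_powr_mean:
  fixes f :: "'a \<Rightarrow> real"
  assumes p: "1 \<le> p" and f: "\<And>x. f x \<in> {0..1}"
  shows "measure_pmf.expectation M f \<le> (\<integral>x. f x powr p \<partial>M) powr (1 / p)"
proof -
  define m where "m = (\<integral>x. f x powr p \<partial>M)"
  have fp: "f x powr p \<in> {0..1}" for x using powr_in_unit f p by auto
  have fpi: "integrable M (\<lambda>x. f x powr p)" using fp by (rule integrable_pmf_unit)
  have m0: "0 \<le> m" using integral_pmf_unit[OF fp] by (simp add: m_def)
  show ?thesis
  proof (cases "m = 0")
    case True
    then have "AE x in M. f x powr p = 0"
      using fp fpi by (subst (asm) m_def, subst (asm) integral_nonneg_eq_0_iff_AE) auto
    then have "AE x in M. f x = 0" by eventually_elim simp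
    then have "measure_pmf.expectation M f = 0" by (simp add: integral_eq_zero_AE)
    then show ?thesis by simp
  next
    case False
    then have m: "m > 0" using m0 by simp
    have "measure_pmf.expectation M f
        \<le> (\<integral>x. m powr (1 / p) * ((1 - 1 / p) + (1 / p) * (f x powr p / m)) \<partial>M)"
    proof (rule integral_mono)
      show "integrable M f" using f by (rule integrable_pmf_unit)
      show "integrable M (\<lambda>x. m powr (1 / p) * ((1 - 1 / p) + (1 / p) * (f x powr p / m)))"
        using fpi by auto
      fix x
      have "f x = m powr (1 / p) * (1 powr (1 - 1 / p) * (f x powr p / m) powr (1 / p))"
        using f[of x] m p by (simp add: powr_divide powr_powr)
      also have "\<dots> \<le> m powr (1 / p) * ((1 - 1 / p) * 1 + (1 / p) * (f x powr p / m))"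
        using m p by (intro mult_left_mono powr_mult_le_weighted_sum) auto
      finally show "f x \<le> m powr (1 / p) * ((1 - 1 / p) + (1 / p) * (f x powr p / m))" by simp
    qed
    also have "\<dots> = m powr (1 / p) * ((1 - 1 / p) + (1 / p) * (m / m))"
      using fpi by (simp add: m_def)
    also have "\<dots> = m powr (1 / p)" using m by simp
    finally show ?thesis by (simp add: m_def)
  qed
qed

text \<open>Independence factors the left side, and each factor is at most its power mean. This
  serves the private coins.\<close>

lemma hypercontractive_independent:
  fixes R :: "'a pmf" and S :: "'b pmf"
  assumes "1 \<le> p" "1 \<le> q"
  shows "hypercontractive p q (pair_pmf R S)"
  unfolding hypercontractive_def
proof safe
  fix f :: "'a \<Rightarrow> real" and g :: "'b \<Rightarrow> real"
  assume "\<forall>x. f x \<in> {0..1}" "\<forall>y. g y \<in> {0..1}"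
  then have fg: "f x \<in> {0..1}" "g y \<in> {0..1}" for x y by blast+
  then have "f x * g y \<in> {0..1}" for x y by (auto simp: mult_le_one)
  then have "(\<integral>z. f (fst z) * g (snd z) \<partial>pair_pmf R S) = measure_pmf.expectation R f * measure_pmf.expectation S g"
    by (subst integral_pair_pmf_unit) auto
  also have "\<dots> \<le> (\<integral>x. f x powr p \<partial>R) powr (1 / p) * (\<integral>y. g y powr q \<partial>S) powr (1 / q)"
    using fg integral_pmf_unit[of f R] integral_pmf_unit[of g S] assms
    by (intro mult_mono expectation_le_powr_mean) auto
  finally show "(\<integral>z. f (fst z) * g (snd z) \<partial>pair_pmf R S)
    \<le> (\<integral>z. f (fst z) powr p \<partial>pair_pmf R S) powr (1 / p)
       * (\<integral>z. g (snd z) powr q \<partial>pair_pmf R S) powr (1 / q)"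
    using expectation_pair_pmf_fst[of R S "\<lambda>x. f x powr p"]
      expectation_pair_pmf_snd[of R S "\<lambda>y. g y powr q"] by simp
qed

section \<open>The doubly symmetric binary source\<close>

text \<open>The marginals confine the support to four points; together with the correlation and the
  total mass they give a linear system that determines the four atoms.\<close>

lemma is_DSBS_expectation:
  assumes "is_DSBS \<rho> \<mu>"
  shows "measure_pmf.expectation \<mu> (h :: int \<times> int \<Rightarrow> real) =
    (1 + \<rho>) / 4 * (h (1, 1) + h (-1, -1)) + (1 - \<rho>) / 4 * (h (1, -1) + h (-1, 1))"
proof -
  have m1: "map_pmf fst \<mu> = pmf_of_set {-1, 1}" and m2: "map_pmf snd \<mu> = pmf_of_set {-1, 1}"
    and e: "measure_pmf.expectation \<mu> (\<lambda>(x, y). real_of_int (x * y)) = \<rho>"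
    using assms by (auto simp: is_DSBS_def)
  have "fst ` set_pmf \<mu> = {-1, 1}" "snd ` set_pmf \<mu> = {-1, 1}"
    using arg_cong[OF m1, of set_pmf] arg_cong[OF m2, of set_pmf] by simp_all
  then have s: "set_pmf \<mu> \<subseteq> {-1, 1} \<times> {-1, 1}" by force
  have E: "measure_pmf.expectation \<mu> h = pmf \<mu> (1, 1) * h (1, 1) + pmf \<mu> (-1, -1) * h (-1, -1)
      + pmf \<mu> (1, -1) * h (1, -1) + pmf \<mu> (-1, 1) * h (-1, 1)" for h :: "int \<times> int \<Rightarrow> real"
    using s by (subst integral_measure_pmf[where A = "{-1, 1} \<times> {-1, 1}"]) auto
  have "measure_pmf.expectation \<mu> (\<lambda>z. indicator {1} (fst z)) = (1/2::real)"
    using arg_cong[OF m1, of "\<lambda>M. measure_pmf.expectation M (indicator {1}) :: real"]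
    unfolding integral_map_pmf by (simp add: measure_pmf_of_set)
  then have 1: "pmf \<mu> (1, 1) + pmf \<mu> (1, -1) = 1/2" unfolding E by simp
  have "measure_pmf.expectation \<mu> (\<lambda>z. indicator {1} (snd z)) = (1/2::real)"
    using arg_cong[OF m2, of "\<lambda>M. measure_pmf.expectation M (indicator {1}) :: real"]
    unfolding integral_map_pmf by (simp add: measure_pmf_of_set)
  then have 2: "pmf \<mu> (1, 1) + pmf \<mu> (-1, 1) = 1/2" unfolding E by simp
  have 3: "pmf \<mu> (1, 1) + pmf \<mu> (-1, -1) + pmf \<mu> (1, -1) + pmf \<mu> (-1, 1) = 1"
    using E[of "\<lambda>_. 1"] by simp
  have 4: "pmf \<mu> (1, 1) + pmf \<mu> (-1, -1) - pmf \<mu> (1, -1) - pmf \<mu> (-1, 1) = \<rho>"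
    using e unfolding E by simp
  have p1: "pmf \<mu> (1, 1) = (1 + \<rho>) / 4" using 1 2 3 4 by argo
  have p2: "pmf \<mu> (-1, -1) = (1 + \<rho>) / 4" using 1 2 3 4 by argo
  have p3: "pmf \<mu> (1, -1) = (1 - \<rho>) / 4" using 1 2 3 4 by argo
  have p4: "pmf \<mu> (-1, 1) = (1 - \<rho>) / 4" using 1 2 3 4 by argo
  show ?thesis unfolding E p1 p2 p3 p4 by (simp add: distrib_left)
qed

text \<open>On two signs every nonnegative function has the form \<open>c * (1 + a X)\<close> with
  \<open>\<bar>a\<bar> \<le> 1\<close>. Both sides are homogeneous, so the constants factor out and
  the two-point inequality remains.\<close>

lemma hypercontractive_DSBS:
  assumes pq: "1 \<le> p" "p \<le> 2" "1 \<le> q" and \<rho>: "0 \<le> \<rho>" "\<rho> \<le> 1" "(p - 1) * (q - 1) = \<rho>\<^sup>2"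
    and D: "is_DSBS \<rho> \<mu>"
  shows "hypercontractive p q \<mu>"
  unfolding hypercontractive_def
proof safe
  fix f g :: "int \<Rightarrow> real"
  assume fg: "\<forall>x. f x \<in> {0..1}" "\<forall>y. g y \<in> {0..1}"
  note E = is_DSBS_expectation[OF D]
  have decomp: "\<exists>c a. 0 \<le> c \<and> \<bar>a\<bar> \<le> 1 \<and> h 1 = c * (1 + a) \<and> h (-1) = c * (1 - a)"
    if "\<forall>x. h x \<in> {0..1}" for h :: "int \<Rightarrow> real"
  \<comment> \<open>The quotient that defines \<open>a\<close> needs a nonzero sum; otherwise
    \<open>h\<close> vanishes at both signs and \<open>c = 0\<close> works.\<close>
  proof (cases "h 1 + h (-1) = 0")
    case True
    then have "h 1 = 0" "h (-1) = 0" using that by (smt (verit) atLeastAtMost_iff)+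
    then show ?thesis by (intro exI[of _ 0]) auto
  next
    case False
    then have "h 1 + h (-1) > 0" using that by (smt (verit) atLeastAtMost_iff)
    moreover have "0 \<le> h 1" "0 \<le> h (-1)" using that by auto
    ultimately show ?thesis
      by (intro exI[of _ "(h 1 + h (-1)) / 2"] exI[of _ "(h 1 - h (-1)) / (h 1 + h (-1))"])
        (auto simp: field_simps abs_le_iff)
  qed
  obtain c a where f: "0 \<le> c" "\<bar>a\<bar> \<le> 1" "f 1 = c * (1 + a)" "f (-1) = c * (1 - a)"
    using decomp[OF fg(1)] by blast
  obtain d b where g: "0 \<le> d" "\<bar>b\<bar> \<le> 1" "g 1 = d * (1 + b)" "g (-1) = d * (1 - b)"
    using decomp[OF fg(2)] by blast
  have norm: "(k * ((1 + z) powr t + (1 - z) powr t) / 2) powr (1 / t) = k powr (1 / t) * two_point_norm t z"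
    if "0 \<le> k" for k z t :: real
    using that unfolding two_point_norm_def by (subst powr_mult[symmetric]) auto
  have F: "(\<integral>z. f (fst z) powr p \<partial>\<mu>) powr (1 / p) = c * two_point_norm p a"
  proof -
    have "(\<integral>z. f (fst z) powr p \<partial>\<mu>) = c powr p * ((1 + a) powr p + (1 - a) powr p) / 2"
      using f unfolding E by (simp add: powr_mult) (simp add: field_simps)
    then have "(\<integral>z. f (fst z) powr p \<partial>\<mu>) powr (1 / p) = (c powr p) powr (1 / p) * two_point_norm p a"
      by (simp only: norm powr_ge_zero)
    then show ?thesis using f pq by (simp add: powr_powr)
  qed
  have G: "(\<integral>z. g (snd z) powr q \<partial>\<mu>) powr (1 / q) = d * two_point_norm q b"
  proof -
    have "(\<integral>z. g (snd z) powr q \<partial>\<mu>) = d powr q * ((1 + b) powr q + (1 - b) powr q) / 2"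
      using g unfolding E by (simp add: powr_mult) (simp add: field_simps)
    then have "(\<integral>z. g (snd z) powr q \<partial>\<mu>) powr (1 / q) = (d powr q) powr (1 / q) * two_point_norm q b"
      by (simp only: norm powr_ge_zero)
    then show ?thesis using g pq by (simp add: powr_powr)
  qed
  have "(\<integral>z. f (fst z) * g (snd z) \<partial>\<mu>) = (c * d) * (1 + \<rho> * a * b)"
    unfolding E by (simp add: f g field_simps)
  also have "\<dots> \<le> (c * d) * (two_point_norm p a * two_point_norm q b)"
    using pq \<rho> f g by (intro mult_left_mono two_function_two_point) auto
  finally show "(\<integral>z. f (fst z) * g (snd z) \<partial>\<mu>)
    \<le> (\<integral>z. f (fst z) powr p \<partial>\<mu>) powr (1 / p) * (\<integral>z. g (snd z) powr q \<partial>\<mu>) powr (1 / q)"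
    unfolding F G by (simp add: mult_ac)
qed

section \<open>From one sample to the local views\<close>

text \<open>Tensorize with one fresh sample, then prepend it by a local map on each side.\<close>

lemma hypercontractive_replicate:
  assumes "1 \<le> p" "1 \<le> q" "hypercontractive p q \<mu>"
  shows "hypercontractive p q (map_pmf (\<lambda>zs. (map fst zs, map snd zs)) (replicate_pmf n \<mu>))"
proof (induction n)
  case 0
  show ?case using assms by (auto simp: hypercontractive_def powr_powr)
next
  case (Suc n)
  have "map_pmf (\<lambda>zs. (map fst zs, map snd zs)) (replicate_pmf (Suc n) \<mu>)
     = map_pmf (map_prod (\<lambda>(x, xs). x # xs) (\<lambda>(y, ys). y # ys))
         (map_pmf (\<lambda>(z, z'). ((fst z, fst z'), (snd z, snd z')))
           (pair_pmf \<mu> (map_pmf (\<lambda>zs. (map fst zs, map snd zs)) (replicate_pmf n \<mu>))))"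
    by (simp add: pair_pmf_def map_pmf_def bind_assoc_pmf bind_return_pmf)
  then show ?case
    using hypercontractive_map_prod[OF hypercontractive_pair[OF assms Suc]] by simp
qed

lemma hypercontractive_local_views:
  assumes "1 \<le> p" "1 \<le> q" "hypercontractive p q \<mu>"
  shows "hypercontractive p q (local_views \<mu> n R S)"
proof -
  have "local_views \<mu> n R S = map_pmf (\<lambda>(z, z'). ((fst z, fst z'), (snd z, snd z')))
      (pair_pmf (map_pmf (\<lambda>zs. (map fst zs, map snd zs)) (replicate_pmf n \<mu>)) (pair_pmf R S))"
    by (simp add: local_views_def pair_map_pmf1 map_pmf_comp split_def apfst_def)
  then show ?thesis
    using hypercontractive_pair[OF assms(1,2) hypercontractive_replicate[OF assms]
        hypercontractive_independent[OF assms(1,2)]] by simp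
qed

text \<open>Indicators are unchanged by \<open>powr\<close>, so their norms are powers of
  probabilities.\<close>

lemma hypercontractive_prob_rectangle:
  fixes M :: "('a \<times> 'b) pmf"
  assumes "hypercontractive p q M"
  shows "measure_pmf.prob M (A \<times> B)
    \<le> measure_pmf.prob M (fst -` A) powr (1 / p) * measure_pmf.prob M (snd -` B) powr (1 / q)"
proof -
  have "(indicator A x :: real) powr p = indicator A x"
    and "(indicator B y :: real) powr q = indicator B y" for x y
    by (auto simp: indicator_def)
  moreover have "(\<lambda>z. indicator A (fst z) * indicator B (snd z)) = (indicator (A \<times> B) :: _ \<Rightarrow> real)"
    "(\<lambda>z. indicator A (fst z)) = (indicator (fst -` A) :: 'a \<times> 'b \<Rightarrow> real)"
    "(\<lambda>z. indicator B (snd z)) = (indicator (snd -` B) :: 'a \<times> 'b \<Rightarrow> real)"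
    by (auto simp: indicator_def fun_eq_iff)
  ultimately show ?thesis
    using hypercontractiveD[OF assms(1), of "indicator A" "indicator B"] by simp
qed

section \<open>Agreement probability of protocols\<close>

text \<open>A bit restricts only the view of its sender, so the views with a given transcript form a
  rectangle. The transcript also determines the leaf, so on it each output depends on one view
  alone.\<close>

lemma transcript_rectangle:
  "\<exists>A B a b. \<forall>u v. (transcript P u v = t \<longleftrightarrow> u \<in> A \<and> v \<in> B) \<and>
     (transcript P u v = t \<longrightarrow> alice_output P u v = a u \<and> bob_output P u v = b v)"
proof (induction P arbitrary: t)
  case (Output f g)
  show ?case
    by (rule exI[of _ "if t = [] then UNIV else {}"], rule exI[of _ UNIV], rule exI[of _ f],
        rule exI[of _ g]) auto
next
  case (Alice_Sends m P Q)
  show ?case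
  proof (cases t)
    \<comment> \<open>An inner node always emits a bit, so the rectangle of the empty transcript is
      empty.\<close>
    case Nil
    then show ?thesis by (intro exI[of _ "{}"]) auto
  next
    case (Cons x t')
    have "\<exists>A B a b. \<forall>u v. (transcript (if x then Q else P) u v = t' \<longleftrightarrow> u \<in> A \<and> v \<in> B) \<and>
      (transcript (if x then Q else P) u v = t' \<longrightarrow>
        alice_output (if x then Q else P) u v = a u \<and> bob_output (if x then Q else P) u v = b v)"
      using Alice_Sends.IH by (cases x) (simp_all only: if_True if_False)
    then obtain A B a b where
      *: "\<forall>u v. (transcript (if x then Q else P) u v = t' \<longleftrightarrow> u \<in> A \<and> v \<in> B) \<and>
      (transcript (if x then Q else P) u v = t' \<longrightarrow>
        alice_output (if x then Q else P) u v = a u \<and> bob_output (if x then Q else P) u v = b v)"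
      by (elim exE) (rule that)
    show ?thesis
      by (rule exI[of _ "{u \<in> A. m u = x}"], rule exI[of _ B], rule exI[of _ a], rule exI[of _ b])
        (use * Cons in \<open>cases x; auto\<close>)
  qed
next
  case (Bob_Sends m P Q)
  show ?case
  proof (cases t)
    case Nil
    then show ?thesis by (intro exI[of _ "{}"]) auto
  next
    case (Cons x t')
    have "\<exists>A B a b. \<forall>u v. (transcript (if x then Q else P) u v = t' \<longleftrightarrow> u \<in> A \<and> v \<in> B) \<and>
      (transcript (if x then Q else P) u v = t' \<longrightarrow>
        alice_output (if x then Q else P) u v = a u \<and> bob_output (if x then Q else P) u v = b v)"
      using Bob_Sends.IH by (cases x) (simp_all only: if_True if_False)
    then obtain A B a b where
      *: "\<forall>u v. (transcript (if x then Q else P) u v = t' \<longleftrightarrow> u \<in> A \<and> v \<in> B) \<and>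
      (transcript (if x then Q else P) u v = t' \<longrightarrow>
        alice_output (if x then Q else P) u v = a u \<and> bob_output (if x then Q else P) u v = b v)"
      by (elim exE) (rule that)
    show ?thesis
      by (rule exI[of _ A], rule exI[of _ "{v \<in> B. m v = x}"], rule exI[of _ a], rule exI[of _ b])
        (use * Cons in \<open>cases x; auto\<close>)
  qed
qed

text \<open>Only countably many fibres over the first coordinate carry mass, and the bound is summed
  over them.\<close>

lemma prob_times_le_fibrewise:
  fixes M :: "('u \<times> 'v) pmf"
  assumes "\<And>u. u \<in> X \<Longrightarrow> measure_pmf.prob M ({u} \<times> B) \<le> d * measure_pmf.prob M ({u} \<times> C)" "0 \<le> d"
  shows "measure_pmf.prob M (X \<times> B) \<le> d * measure_pmf.prob M (X \<times> C)"
proof -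
  define I where "I = X \<inter> fst ` set_pmf M"
  have I: "countable I" unfolding I_def by (simp add: countable_Int2)
  have E: "emeasure M (X \<times> D) = (\<integral>\<^sup>+u. ennreal (measure_pmf.prob M ({u} \<times> D)) \<partial>count_space I)" for D
  proof -
    have "emeasure M (X \<times> D) = emeasure M (\<Union>u\<in>I. {u} \<times> D)"
      by (rule emeasure_eq_AE) (force simp: AE_measure_pmf_iff I_def)+
    also have "\<dots> = (\<integral>\<^sup>+u. emeasure M ({u} \<times> D) \<partial>count_space I)"
      using I by (intro emeasure_UN_countable) (auto simp: disjoint_family_on_def)
    finally show ?thesis by (simp add: measure_pmf.emeasure_eq_measure)
  qed
  have "emeasure M (X \<times> B) \<le> (\<integral>\<^sup>+u. ennreal d * ennreal (measure_pmf.prob M ({u} \<times> C)) \<partial>count_space I)"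
    unfolding E
    by (intro nn_integral_mono)
      (use assms in \<open>auto simp: I_def ennreal_mult[symmetric] intro!: ennreal_leI\<close>)
  also have "\<dots> = ennreal d * emeasure M (X \<times> C)"
    unfolding E by (simp add: nn_integral_cmult)
  finally show ?thesis using assms(2)
    by (simp add: measure_pmf.emeasure_eq_measure ennreal_mult[symmetric])
qed

text \<open>Double counting: the sum is the expected number of events that occur.\<close>

lemma sum_prob_le_multiplicity:
  assumes "finite I" "\<And>z. card {i \<in> I. z \<in> E i} \<le> b"
  shows "(\<Sum>i\<in>I. measure_pmf.prob M (E i)) \<le> real b"
proof -
  have "(\<Sum>i\<in>I. measure_pmf.prob M (E i)) = (\<integral>z. (\<Sum>i\<in>I. indicator (E i) z) \<partial>M)"
    by (subst Bochner_Integration.integral_sum) (auto simp: integrable_pmf_unit indicator_def)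
  also have "\<dots> = (\<integral>z. real (card {i \<in> I. z \<in> E i}) \<partial>M)"
    using assms(1) by (intro Bochner_Integration.integral_cong)
      (auto simp: indicator_def of_bool_def sum.If_cases Int_def)
  also have "\<dots> \<le> real b"
    using assms by (intro measure_pmf.integral_le_const measure_pmf.integrable_const_bound[where B = "real b"]) auto
  finally show ?thesis .
qed

lemma sum_prob_rectangles_le:
  assumes HC: "hypercontractive p q M" "1 \<le> q" "1 \<le> 1 / p + 1 / q"
    and m: "\<And>i. i \<in> I \<Longrightarrow> measure_pmf.prob M (A i \<times> UNIV) \<le> m"
    and F: "0 < F" "(\<Sum>i\<in>I. measure_pmf.prob M (A i \<times> UNIV)) \<le> F"
    and G: "0 < G" "(\<Sum>i\<in>I. measure_pmf.prob M (UNIV \<times> B i)) \<le> G"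
  shows "(\<Sum>i\<in>I. measure_pmf.prob M (A i \<times> B i))
    \<le> m powr (1 / p + 1 / q - 1) * (F powr (1 - 1 / q) * G powr (1 / q))"
proof -
  have v: "fst -` X = X \<times> UNIV" "snd -` Y = UNIV \<times> Y" for X :: "'a set" and Y :: "'b set" by auto
  have "(\<Sum>i\<in>I. measure_pmf.prob M (A i \<times> B i)) \<le>
     (\<Sum>i\<in>I. measure_pmf.prob M (A i \<times> UNIV) powr (1 / p) * measure_pmf.prob M (UNIV \<times> B i) powr (1 / q))"
    using hypercontractive_prob_rectangle[OF HC(1)] unfolding v by (intro sum_mono)
  also have "\<dots> \<le> m powr (1 / p + 1 / q - 1) * (F powr (1 - 1 / q) * G powr (1 / q))"
    using assms by (intro sum_powr_mult_powr_le_bounded) auto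
  finally show ?thesis .
qed

text \<open>Continuity from below; this cuts the infinitely many possible outputs down to finite
  sums.\<close>

lemma prob_le_truncation:
  fixes h :: "'z \<Rightarrow> nat"
  assumes "\<And>N. measure_pmf.prob M {z \<in> E. h z < N} \<le> x"
  shows "measure_pmf.prob M E \<le> x"
proof -
  have "(\<lambda>N. measure_pmf.prob M {z \<in> E. h z < N}) \<longlonglongrightarrow> measure_pmf.prob M (\<Union>N. {z \<in> E. h z < N})"
    by (intro measure_pmf.finite_Lim_measure_incseq) (auto simp: incseq_def)
  moreover have "(\<Union>N. {z \<in> E. h z < N}) = E" by auto
  ultimately show ?thesis using assms by (auto intro: LIMSEQ_le_const2)
qed

text \<open>A geometric sum over all lengths up to \<open>c\<close>, since executions may stop
  early.\<close>

lemma card_transcripts_le: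
  "finite {t :: bool list. length t \<le> c}" "card {t :: bool list. length t \<le> c} \<le> 2 ^ Suc c"
proof -
  have eq: "{t :: bool list. length t \<le> c} = {t. set t \<subseteq> UNIV \<and> length t \<le> c}" by simp
  show "finite {t :: bool list. length t \<le> c}" unfolding eq by (rule finite_lists_length_le) simp
  have "card {t :: bool list. length t \<le> c} = (\<Sum>i\<le>c. 2 ^ i)"
    unfolding eq by (subst card_lists_length_le) auto
  also have "\<dots> = (\<Sum>i<Suc c. 2 ^ i)" by (simp add: lessThan_Suc_atMost)
  also have "\<dots> \<le> 2 ^ Suc c" using mask_eq_sum_exp_nat[of "Suc c"] by (simp add: lessThan_def)
  finally show "card {t :: bool list. length t \<le> c} \<le> 2 ^ Suc c" .
qed

text \<open>Fixing the transcript \<open>t\<close> leaves a rectangle \<open>A t \<times> B t\<close>. The min-entropy only bounds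
  the probability of Alice's output jointly with \<open>v \<in> B t\<close>, so the views \<open>u\<close> for which
  \<open>v \<in> B t\<close> has conditional probability below \<open>d\<close> are discarded, at a cost of \<open>d\<close> per transcript;
  for the others, dropping the event \<open>v \<in> B t\<close> costs a factor \<open>1 / d\<close>.\<close>

lemma agreement_prob_le:
  fixes M :: "('u \<times> 'v) pmf" and P :: "('u, 'v, nat) protocol"
  assumes HC: "hypercontractive p q M" "1 \<le> q" "1 \<le> 1 / p + 1 / q"
    and ent: "\<And>w. measure_pmf.prob M {(u, v). alice_output P u v = w} \<le> m"
    and list: "\<And>u v. (u, v) \<in> set_pmf M \<Longrightarrow> length (bob_output P u v) \<le> b"
    and comm: "\<And>u v. (u, v) \<in> set_pmf M \<Longrightarrow> length (transcript P u v) \<le> c"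
    and d: "0 < d" and b: "1 \<le> b"
  shows "measure_pmf.prob M {(u, v). alice_output P u v \<in> set (bob_output P u v)}
    \<le> 2 ^ Suc c * d + (m / d) powr (1 / p + 1 / q - 1)
        * ((1 / d) powr (1 - 1 / q) * (2 ^ Suc c * real b) powr (1 / q))"
    (is "_ \<le> ?rhs")
proof (rule prob_le_truncation[where h = "\<lambda>(u, v). alice_output P u v"])
  fix N :: nat
  define T where "T = {t :: bool list. length t \<le> c}"
  have T: "finite T" "card T \<le> 2 ^ Suc c" using card_transcripts_le unfolding T_def by auto
  have T': "real (card T) \<le> 2 ^ Suc c"
    using of_nat_mono[OF T(2), where 'a = real] by simp
  obtain A B a bo where rect: "\<And>t u v. transcript P u v = t \<longleftrightarrow> u \<in> A t \<and> v \<in> B t"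
    "\<And>t u v. transcript P u v = t \<Longrightarrow> alice_output P u v = a t u \<and> bob_output P u v = bo t v"
    using transcript_rectangle[of P] by metis
  have rectD: "transcript P u v = t \<and> alice_output P u v = a t u" if "u \<in> A t" "v \<in> B t" for t u v
    using that rect by blast
  \<comment> \<open>The conditional probability of \<open>v \<in> B t\<close> given \<open>u\<close>
    is below \<open>d\<close>, written without division so that views \<open>u\<close> of
    probability zero need no separate case.\<close>
  define light where "light t u \<longleftrightarrow>
    measure_pmf.prob M ({u} \<times> B t) < d * measure_pmf.prob M ({u} \<times> UNIV)" for t u
  define A' where "A' = (\<lambda>(t, w). {u \<in> A t. a t u = w \<and> \<not> light t u})"
  \<comment> \<open>The length test enforces the bound \<open>b\<close> for every \<open>v\<close>;
    the protocol guarantees it only on the support.\<close>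
  define B' where "B' = (\<lambda>(t, w). {v \<in> B t. w \<in> set (bo t v) \<and> length (bo t v) \<le> b})"
  define I where "I = T \<times> {..<N}"
  have I: "finite I" using T by (simp add: I_def)
  \<comment> \<open>A pair in \<open>A t \<times> B t\<close> has transcript \<open>t\<close> and
    output \<open>a t u\<close>, so these rectangles are disjoint.\<close>
  have disj: "card {i \<in> I. z \<in> A' i \<times> B (fst i)} \<le> 1" for z
  proof -
    obtain u v where z: "z = (u, v)" by (cases z)
    have "{i \<in> I. z \<in> A' i \<times> B (fst i)} \<subseteq> {(transcript P u v, alice_output P u v)}"
      using rectD by (force simp: z A'_def)
    then have "card {i \<in> I. z \<in> A' i \<times> B (fst i)} \<le> card {(transcript P u v, alice_output P u v)}"
      by (intro card_mono) auto
    then show ?thesis by simp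
  qed
  have heavy: "measure_pmf.prob M (A' i \<times> UNIV) \<le> 1 / d * measure_pmf.prob M (A' i \<times> B (fst i))" for i
  proof (rule prob_times_le_fibrewise)
    fix u assume "u \<in> A' i"
    then have "d * measure_pmf.prob M ({u} \<times> UNIV) \<le> measure_pmf.prob M ({u} \<times> B (fst i))"
      by (cases i) (simp add: A'_def light_def not_less)
    then show "measure_pmf.prob M ({u} \<times> UNIV) \<le> 1 / d * measure_pmf.prob M ({u} \<times> B (fst i))"
      using d by (simp add: field_simps)
  qed (use d in simp)
  \<comment> \<open>Only together with \<open>v \<in> B t\<close> is \<open>a t u\<close> the actual
    output of Alice, so the entropy bound is paid for with the factor \<open>1 / d\<close>.\<close>
  have 1: "measure_pmf.prob M (A' i \<times> UNIV) \<le> m / d" for i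
  proof -
    have "measure_pmf.prob M (A' i \<times> B (fst i)) \<le> measure_pmf.prob M {(u, v). alice_output P u v = snd i}"
      using rectD by (intro measure_pmf.finite_measure_mono) (cases i, force simp: A'_def)+
    also have "\<dots> \<le> m" by (rule ent)
    finally show ?thesis using order_trans[OF heavy[of i], of "m / d"] d by (simp add: divide_right_mono)
  qed
  have 2: "(\<Sum>i\<in>I. measure_pmf.prob M (A' i \<times> UNIV)) \<le> 1 / d"
  proof -
    have "(\<Sum>i\<in>I. measure_pmf.prob M (A' i \<times> UNIV)) \<le> (\<Sum>i\<in>I. 1 / d * measure_pmf.prob M (A' i \<times> B (fst i)))"
      by (intro sum_mono heavy)
    also have "\<dots> = 1 / d * (\<Sum>i\<in>I. measure_pmf.prob M (A' i \<times> B (fst i)))"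
      by (simp add: sum_distrib_left)
    also have "\<dots> \<le> 1 / d * real 1"
      using d by (intro mult_left_mono sum_prob_le_multiplicity I disj) auto
    finally show ?thesis by simp
  qed
  \<comment> \<open>Bob's sides may overlap across transcripts: each transcript contributes up to
    \<open>b\<close> list elements.\<close>
  have 3: "(\<Sum>i\<in>I. measure_pmf.prob M (UNIV \<times> B' i)) \<le> 2 ^ Suc c * real b"
  proof -
    have "(\<Sum>i\<in>I. measure_pmf.prob M (UNIV \<times> B' i))
        = (\<Sum>t\<in>T. \<Sum>w<N. measure_pmf.prob M (UNIV \<times> B' (t, w)))"
      unfolding I_def by (simp add: sum.cartesian_product)
    also have "\<dots> \<le> (\<Sum>t\<in>T. real b)"
    proof (intro sum_mono sum_prob_le_multiplicity)
      fix t z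
      show "card {w \<in> {..<N}. z \<in> UNIV \<times> B' (t, w)} \<le> b"
      proof (cases "length (bo t (snd z)) \<le> b")
        case True
        have "card {w \<in> {..<N}. z \<in> UNIV \<times> B' (t, w)} \<le> card (set (bo t (snd z)))"
          by (intro card_mono) (auto simp: B'_def)
        then show ?thesis using True card_length[of "bo t (snd z)"] by linarith
      next
        case False
        then have "{w \<in> {..<N}. z \<in> UNIV \<times> B' (t, w)} = {}" by (auto simp: B'_def)
        then show ?thesis by (simp only: card.empty)
      qed
    qed simp
    also have "\<dots> = real (card T) * real b" by simp
    also have "\<dots> \<le> 2 ^ Suc c * real b"
      using T' by (intro mult_right_mono) auto
    finally show ?thesis .
  qed
  have 4: "(\<Sum>t\<in>T. measure_pmf.prob M ({u. light t u} \<times> B t)) \<le> 2 ^ Suc c * d"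
  proof -
    have "measure_pmf.prob M ({u. light t u} \<times> B t) \<le> d" for t
    proof -
      have "measure_pmf.prob M ({u. light t u} \<times> B t) \<le> d * measure_pmf.prob M ({u. light t u} \<times> UNIV)"
      proof (rule prob_times_le_fibrewise)
        fix u assume "u \<in> {u. light t u}"
        then have "light t u" by simp
        then show "measure_pmf.prob M ({u} \<times> B t) \<le> d * measure_pmf.prob M ({u} \<times> UNIV)"
          unfolding light_def by (rule less_imp_le)
      qed (use d in simp)
      also have "\<dots> \<le> d * 1" using d by (intro mult_left_mono) auto
      finally show ?thesis by simp
    qed
    then have "(\<Sum>t\<in>T. measure_pmf.prob M ({u. light t u} \<times> B t)) \<le> (\<Sum>t\<in>T. d)" by (intro sum_mono)
    also have "\<dots> = real (card T) * d" by simp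
    also have "\<dots> \<le> 2 ^ Suc c * d"
      using T' d by (intro mult_right_mono) auto
    finally show ?thesis .
  qed
  let ?S = "{z \<in> {(u, v). alice_output P u v \<in> set (bob_output P u v)}.
     (case z of (u, v) \<Rightarrow> alice_output P u v) < N}"
  \<comment> \<open>On the support, an agreeing pair lies in the rectangle of its own transcript and
    output unless \<open>u\<close> is light for that transcript.\<close>
  have "?S \<inter> set_pmf M \<subseteq> (\<Union>t\<in>T. {u. light t u} \<times> B t) \<union> (\<Union>i\<in>I. A' i \<times> B' i)"
  proof safe
    fix u v
    assume z: "alice_output P u v \<in> set (bob_output P u v)" "alice_output P u v < N" "(u, v) \<in> set_pmf M"
      "(u, v) \<notin> (\<Union>i\<in>I. A' i \<times> B' i)"
    define t where "t = transcript P u v"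
    have t: "t \<in> T" "u \<in> A t" "v \<in> B t" "alice_output P u v = a t u" "bob_output P u v = bo t v"
      using rect(1)[of u v t] rect(2)[of u v t] comm[OF z(3)] by (simp_all add: T_def t_def[symmetric])
    have "(t, a t u) \<in> I" using t z by (simp add: I_def)
    then have "(u, v) \<notin> A' (t, a t u) \<times> B' (t, a t u)" using z(4) by blast
    then have "light t u" using t z(1) list[OF z(3)] by (auto simp: A'_def B'_def)
    then show "(u, v) \<in> (\<Union>t\<in>T. {u. light t u} \<times> B t)" using t by blast
  qed
  then have "measure_pmf.prob M ?S
      \<le> measure_pmf.prob M ((\<Union>t\<in>T. {u. light t u} \<times> B t) \<union> (\<Union>i\<in>I. A' i \<times> B' i))"
    by (subst measure_Int_set_pmf[symmetric]) (intro measure_pmf.finite_measure_mono, auto)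
  also have "\<dots> \<le> measure_pmf.prob M (\<Union>t\<in>T. {u. light t u} \<times> B t) + measure_pmf.prob M (\<Union>i\<in>I. A' i \<times> B' i)"
    by (intro measure_Un_le) auto
  also have "\<dots> \<le> (\<Sum>t\<in>T. measure_pmf.prob M ({u. light t u} \<times> B t)) + (\<Sum>i\<in>I. measure_pmf.prob M (A' i \<times> B' i))"
    using T I by (intro add_mono measure_pmf.finite_measure_subadditive_finite) auto
  also have "\<dots> \<le> ?rhs"
    using HC 1 2 3 4 d b by (intro add_mono sum_prob_rectangles_le) auto
  finally show "measure_pmf.prob M ?S \<le> ?rhs" .
qed

text \<open>Alice's output depends on her view alone, so her sides are disjoint and no view is
  discarded: the losses \<open>1 / d\<close> and \<open>2 ^ Suc c\<close> disappear.\<close>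

lemma agreement_prob_le_no_communication:
  fixes M :: "('u \<times> 'v) pmf" and f :: "'u \<Rightarrow> nat"
  assumes HC: "hypercontractive p q M" "1 \<le> q" "1 \<le> 1 / p + 1 / q"
    and ent: "\<And>w. measure_pmf.prob M {(u, v). f u = w} \<le> m"
    and list: "\<And>u v. (u, v) \<in> set_pmf M \<Longrightarrow> length (g v) \<le> b"
    and b: "1 \<le> b"
  shows "measure_pmf.prob M {(u, v). f u \<in> set (g v)} \<le> m powr (1 / p + 1 / q - 1) * real b powr (1 / q)"
    (is "_ \<le> ?rhs")
proof (rule prob_le_truncation[where h = "\<lambda>(u, v). f u"])
  fix N :: nat
  define A where "A w = {u. f u = w}" for w
  define B where "B w = {v. w \<in> set (g v) \<and> length (g v) \<le> b}" for w
  let ?S = "{z \<in> {(u, v). f u \<in> set (g v)}. (case z of (u, v) \<Rightarrow> f u) < N}"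
  have 1: "measure_pmf.prob M (A w \<times> UNIV) \<le> m" for w
  proof -
    have "A w \<times> (UNIV :: 'v set) = {(u, v). f u = w}" by (auto simp: A_def)
    then show ?thesis using ent by simp
  qed
  have 2: "(\<Sum>w<N. measure_pmf.prob M (A w \<times> UNIV)) \<le> real 1"
  proof (rule sum_prob_le_multiplicity)
    fix z :: "'u \<times> 'v"
    have "card {w \<in> {..<N}. z \<in> A w \<times> UNIV} \<le> card {f (fst z)}"
      by (intro card_mono) (auto simp: A_def)
    then show "card {w \<in> {..<N}. z \<in> A w \<times> UNIV} \<le> 1" by simp
  qed simp
  have 3: "(\<Sum>w<N. measure_pmf.prob M (UNIV \<times> B w)) \<le> real b"
  proof (rule sum_prob_le_multiplicity)
    fix z :: "'u \<times> 'v"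
    show "card {w \<in> {..<N}. z \<in> UNIV \<times> B w} \<le> b"
    proof (cases "length (g (snd z)) \<le> b")
      case True
      have "card {w \<in> {..<N}. z \<in> UNIV \<times> B w} \<le> card (set (g (snd z)))"
        by (intro card_mono) (auto simp: B_def)
      then show ?thesis using True card_length[of "g (snd z)"] by linarith
    next
      case False
      then have "{w \<in> {..<N}. z \<in> UNIV \<times> B w} = {}" by (auto simp: B_def)
      then show ?thesis by (simp only: card.empty)
    qed
  qed simp
  have "?S \<inter> set_pmf M \<subseteq> (\<Union>w<N. A w \<times> B w)"
    using list by (auto simp: A_def B_def)
  then have "measure_pmf.prob M ?S \<le> measure_pmf.prob M (\<Union>w<N. A w \<times> B w)"
    by (subst measure_Int_set_pmf[symmetric]) (intro measure_pmf.finite_measure_mono, auto)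
  also have "\<dots> \<le> (\<Sum>w<N. measure_pmf.prob M (A w \<times> B w))"
    by (intro measure_pmf.finite_measure_subadditive_finite) auto
  also have "\<dots> \<le> m powr (1 / p + 1 / q - 1) * (1 powr (1 - 1 / q) * real b powr (1 / q))"
    using HC 1 2 3 b by (intro sum_prob_rectangles_le) auto
  finally show "measure_pmf.prob M ?S \<le> ?rhs" by simp
qed

section \<open>The communication lower bound\<close>

text \<open>The exponents maximise \<open>1 / p - 1 + s\<^sup>2 / q\<close> subject to \<open>(p - 1) (q - 1) = \<rho>\<^sup>2\<close>.\<close>

lemma optimal_exponents:
  fixes \<rho> s :: real
  assumes \<rho>: "0 \<le> \<rho>" and s: "\<rho> < s" "s \<le> 1"
  obtains p q where "1 \<le> p" "p \<le> 2" "1 \<le> q" "(p - 1) * (q - 1) = \<rho>\<^sup>2" "1 \<le> 1 / p + 1 / q"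
    "1 / p - 1 + s\<^sup>2 / q = (s - \<rho>)\<^sup>2 / (1 - \<rho>\<^sup>2)"
proof -
  \<comment> \<open>Apart from \<open>\<rho>\<close>, the fractions in \<open>p - 1\<close> and
    \<open>q - 1\<close> are reciprocal, which makes their product
    \<open>\<rho>\<^sup>2\<close>.\<close>
  define p where "p = 1 + \<rho> * (s - \<rho>) / (1 - s * \<rho>)"
  define q where "q = 1 + \<rho> * (1 - s * \<rho>) / (s - \<rho>)"
  have "s * \<rho> \<le> 1 * \<rho>" using assms by (intro mult_right_mono) auto
  then have e: "1 - s * \<rho> > 0" using assms by simp
  have \<rho>2: "1 - \<rho>\<^sup>2 > 0" using assms by (simp add: abs_square_less_1)
  have p1: "1 \<le> p" using \<rho> s e by (simp add: p_def)
  have q1: "1 \<le> q" using \<rho> s e by (simp add: q_def)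
  \<comment> \<open>This is \<open>p \<le> 2\<close> with the denominator cleared.\<close>
  have "2 * (s * \<rho>) \<le> 1 + \<rho>\<^sup>2"
    using \<open>s * \<rho> \<le> 1 * \<rho>\<close> zero_le_power2[of "1 - \<rho>"] by (simp add: power2_diff)
  then have p2: "p \<le> 2" using e by (simp add: p_def field_simps power2_eq_square)
  have pq: "(p - 1) * (q - 1) = \<rho>\<^sup>2" using e s by (simp add: p_def q_def power2_eq_square)
  have "p * q \<le> p + q" using pq \<rho>2 by (simp add: algebra_simps)
  then have r: "1 \<le> 1 / p + 1 / q" using p1 q1 by (simp add: field_simps)
  have "p = (1 - \<rho>\<^sup>2) / (1 - s * \<rho>)" using e by (simp add: p_def field_simps power2_eq_square)
  then have ip: "1 / p = (1 - s * \<rho>) / (1 - \<rho>\<^sup>2)" by simp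
  have "q = s * (1 - \<rho>\<^sup>2) / (s - \<rho>)" using s by (simp add: q_def field_simps power2_eq_square)
  then have iq: "1 / q = (s - \<rho>) / (s * (1 - \<rho>\<^sup>2))" by simp
  have "s\<^sup>2 / q = s\<^sup>2 * (1 / q)" by simp
  also have "\<dots> = s * (s - \<rho>) / (1 - \<rho>\<^sup>2)" unfolding iq using s \<rho> \<rho>2 by (simp add: power2_eq_square)
  finally have "1 / p - 1 + s\<^sup>2 / q = (1 - s * \<rho>) / (1 - \<rho>\<^sup>2) - (1 - \<rho>\<^sup>2) / (1 - \<rho>\<^sup>2) + s * (s - \<rho>) / (1 - \<rho>\<^sup>2)"
    unfolding ip using \<rho>2 by simp
  also have "\<dots> = ((1 - s * \<rho>) - (1 - \<rho>\<^sup>2) + s * (s - \<rho>)) / (1 - \<rho>\<^sup>2)"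
    by (simp only: add_divide_distrib diff_divide_distrib)
  also have "(1 - s * \<rho>) - (1 - \<rho>\<^sup>2) + s * (s - \<rho>) = (s - \<rho>)\<^sup>2"
    by (simp add: power2_eq_square algebra_simps)
  finally show thesis using that p1 p2 q1 pq r by blast
qed

text \<open>Some point has positive mass, so the supremum is positive and the logarithm can be
  inverted.\<close>

lemma pmf_le_of_min_entropy_ge:
  assumes "k \<le> min_entropy p"
  shows "pmf p w \<le> 2 powr (- k)"
proof -
  define S where "S = (SUP w. pmf p w)"
  have bdd: "bdd_above (range (pmf p))" by (rule bdd_aboveI[of _ 1]) (auto simp: pmf_le_1)
  have le: "pmf p x \<le> S" for x unfolding S_def by (rule cSUP_upper[OF _ bdd]) simp
  obtain x where "x \<in> set_pmf p" using set_pmf_not_empty[of p] by blast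
  then have "0 < S" using order_less_le_trans[OF pmf_positive le] by blast
  moreover have "log 2 S \<le> - k" using assms by (simp add: min_entropy_def S_def)
  ultimately have "S \<le> 2 powr (- k)" by (simp add: log_le_iff)
  then show ?thesis using le order_trans by blast
qed

lemma length_transcript_le_communication:
  assumes "(u, v) \<in> set_pmf (local_views \<mu> n R S)"
  shows "length (transcript P u v) \<le> communication \<mu> n R S P"
  unfolding communication_def using assms
  by (intro Max_ge finite_communication_set) (auto intro!: rev_image_eqI)

section \<open>The exponent and the bounds for a fixed protocol\<close>

text \<open>The denominator equals \<open>4 * \<epsilon> * (1 - \<epsilon>)\<close>, so half of this
  exponent is the coefficient of \<open>k\<close> in the theorem.\<close>

definition agreement_exponent :: "real \<Rightarrow> real \<Rightarrow> nat \<Rightarrow> real" where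
  "agreement_exponent \<epsilon> k b =
     (sqrt (1 - log 2 (real b) / k) - (1 - 2 * \<epsilon>))\<^sup>2 / (1 - (1 - 2 * \<epsilon>)\<^sup>2)"

context
  fixes \<epsilon> k \<gamma> :: real and b n :: nat and \<mu> :: "(int \<times> int) pmf" and R S :: "nat pmf"
    and P :: "(int list \<times> nat, int list \<times> nat, nat) protocol"
  assumes \<epsilon>: "0 < \<epsilon>" "\<epsilon> \<le> 1/2" and k: "0 < k" and b: "1 \<le> b" and \<gamma>: "0 < \<gamma>" "\<gamma> \<le> 1"
    and rate: "log 2 (real b) / k \<le> 4 * \<epsilon> * (1 - \<epsilon>)"
    and source: "is_DSBS (1 - 2 * \<epsilon>) \<mu>"
    and solves: "solves_list_common_randomness k \<gamma> b \<mu> n R S P"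
begin

private abbreviation "M \<equiv> local_views \<mu> n R S"

private lemma agreement: "\<gamma> \<le> measure_pmf.prob M {(u, v). alice_output P u v \<in> set (bob_output P u v)}"
  using solves by (simp add: solves_list_common_randomness_def)

private lemma output_prob: "measure_pmf.prob M {(u, v). alice_output P u v = w} \<le> 2 powr (- k)"
proof -
  have "pmf (map_pmf (\<lambda>(u, v). alice_output P u v) M) w \<le> 2 powr (- k)"
    using solves by (intro pmf_le_of_min_entropy_ge) (simp add: solves_list_common_randomness_def)
  moreover have "(\<lambda>(u, v). alice_output P u v) -` {w} = {(u, v). alice_output P u v = w}" by auto
  ultimately show ?thesis by (simp add: pmf_map)
qed

private lemma list_size: "(u, v) \<in> set_pmf M \<Longrightarrow> length (bob_output P u v) \<le> b"
  using solves by (auto simp: solves_list_common_randomness_def)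

private abbreviation "h \<equiv> agreement_exponent \<epsilon> k b"

text \<open>The alternative \<open>h = 0\<close> covers \<open>s = \<rho>\<close>, where the formula
  for the optimal \<open>q\<close> divides by zero. Otherwise the optimal exponents turn the bound
  without communication into \<open>2 powr (- (k * h))\<close>.\<close>

private lemma exponents:
  obtains "h = 0"
  | p q where "1 \<le> p" "1 \<le> q" "1 \<le> 1 / p + 1 / q" "hypercontractive p q M"
      "(2 powr (- k)) powr (1 / p + 1 / q - 1) * real b powr (1 / q) = 2 powr (- (k * h))"
proof -
  define \<rho> where "\<rho> = 1 - 2 * \<epsilon>"
  define s where "s = sqrt (1 - log 2 (real b) / k)"
  have \<rho>: "0 \<le> \<rho>" "\<rho> < 1" using \<epsilon> by (auto simp: \<rho>_def)
  \<comment> \<open>A restatement of the rate hypothesis; it makes the root real and gives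
    \<open>\<rho> \<le> s\<close>.\<close>
  have "\<rho>\<^sup>2 \<le> 1 - log 2 (real b) / k"
    using rate by (simp add: \<rho>_def power2_eq_square algebra_simps)
  moreover from this have "0 \<le> 1 - log 2 (real b) / k"
    by (rule order_trans[OF zero_le_power2])
  ultimately have s2: "s\<^sup>2 = 1 - log 2 (real b) / k" and \<rho>s: "\<rho> \<le> s"
    unfolding s_def by (auto intro!: real_le_rsqrt)
  have "log 2 (real b) / k \<ge> 0" using b k by simp
  then have s1: "s \<le> 1" by (simp add: s_def)
  show thesis
  proof (cases "\<rho> = s")
    case True
    then have "h = 0" by (simp add: agreement_exponent_def \<rho>_def s_def)
    then show thesis by (rule that(1))
  next
    case False
    then have "\<rho> < s" using \<rho>s by simp
    then obtain p q where pq: "1 \<le> p" "p \<le> 2" "1 \<le> q" "(p - 1) * (q - 1) = \<rho>\<^sup>2" "1 \<le> 1 / p + 1 / q"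
      "1 / p - 1 + s\<^sup>2 / q = (s - \<rho>)\<^sup>2 / (1 - \<rho>\<^sup>2)"
      using optimal_exponents[OF \<rho>(1) _ s1] by blast
    have "hypercontractive p q \<mu>"
      using hypercontractive_DSBS[OF pq(1-3) \<rho>(1) _ pq(4)] \<rho> source by (simp add: \<rho>_def)
    then have HC: "hypercontractive p q M" using pq by (intro hypercontractive_local_views)
    \<comment> \<open>With \<open>b\<close> as a power of 2, both factors merge into a single
      exponent.\<close>
    have lb: "log 2 (real b) = k * (1 - s\<^sup>2)" using s2 k by (simp add: field_simps)
    have "real b = 2 powr (k * (1 - s\<^sup>2))" using b by (simp flip: lb)
    then have "real b powr (1 / q) = 2 powr (k * (1 - s\<^sup>2) * (1 / q))" by (simp only: powr_powr)
    then have "(2 powr (- k)) powr (1 / p + 1 / q - 1) * real b powr (1 / q)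
        = 2 powr (- k * (1 / p + 1 / q - 1) + k * (1 - s\<^sup>2) * (1 / q))"
      by (simp only: powr_powr powr_add)
    also have "- k * (1 / p + 1 / q - 1) + k * (1 - s\<^sup>2) * (1 / q) = - (k * (1 / p - 1 + s\<^sup>2 / q))"
      by (simp add: algebra_simps diff_divide_distrib)
    also have "1 / p - 1 + s\<^sup>2 / q = h"
      using pq(6) by (simp add: agreement_exponent_def \<rho>_def[symmetric] s_def[symmetric])
    finally show thesis using that(2) pq HC by blast
  qed
qed

lemma communication_lower_bound:
  "k * h \<le> 2 * real (communication \<mu> n R S P) + 4 + 2 * log 2 (1 / \<gamma>)"
proof (rule exponents)
  have "0 \<le> log 2 (1 / \<gamma>)" using \<gamma> by simp
  then show ?thesis if "h = 0" using that by simp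
next
  fix p q
  assume pq: "1 \<le> p" "1 \<le> q" "1 \<le> 1 / p + 1 / q" and HC: "hypercontractive p q M"
    and eq: "(2 powr (- k)) powr (1 / p + 1 / q - 1) * real b powr (1 / q) = 2 powr (- (k * h))"
  define c where "c = communication \<mu> n R S P"
  define K :: real where "K = 2 ^ Suc c"
  \<comment> \<open>Chosen so that the light views use up half of \<open>\<gamma>\<close>.\<close>
  define d where "d = \<gamma> / (2 * K)"
  have K1: "1 \<le> K" unfolding K_def by (rule one_le_power) simp
  have d0: "0 < d" and d1: "1 \<le> 1 / d" and dK: "K * d = \<gamma> / 2"
    using \<gamma> K1 by (auto simp: d_def field_simps)
  have "\<gamma> \<le> K * d + (2 powr (- k) / d) powr (1 / p + 1 / q - 1)
        * ((1 / d) powr (1 - 1 / q) * (K * real b) powr (1 / q))"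
    unfolding K_def c_def
    by (rule order_trans[OF agreement agreement_prob_le[OF HC pq(2,3) output_prob list_size
            length_transcript_le_communication d0 b]])
  also have "(2 powr (- k) / d) powr (1 / p + 1 / q - 1) * ((1 / d) powr (1 - 1 / q) * (K * real b) powr (1 / q))
     = 2 powr (- (k * h)) * ((1 / d) powr (1 / p) * K powr (1 / q))"
  proof -
    have "2 powr (- k) / d = 2 powr (- k) * (1 / d)" by simp
    then have 1: "(2 powr (- k) / d) powr (1 / p + 1 / q - 1)
        = (2 powr (- k)) powr (1 / p + 1 / q - 1) * (1 / d) powr (1 / p + 1 / q - 1)"
      using d0 by (simp only: powr_mult)
    have 2: "(K * real b) powr (1 / q) = K powr (1 / q) * real b powr (1 / q)"
      using K1 by (simp add: powr_mult)
    have 3: "(1 / d) powr (1 / p + 1 / q - 1) * (1 / d) powr (1 - 1 / q) = (1 / d) powr (1 / p)"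
      by (simp flip: powr_add)
    show ?thesis unfolding 1 2 3[symmetric] eq[symmetric] by (simp only: mult_ac)
  qed
  \<comment> \<open>Both bases are at least 1, so the exponents \<open>1 / p\<close> and
    \<open>1 / q\<close> may be raised to 1; the total loss is \<open>K / d\<close>.\<close>
  also have "\<dots> \<le> 2 powr (- (k * h)) * ((1 / d) powr 1 * K powr 1)"
    using pq d1 K1 by (intro mult_left_mono mult_mono powr_mono) auto
  also have "\<dots> = 2 powr (- (k * h)) * (2 * K\<^sup>2 / \<gamma>)"
    using \<gamma> K1 by (simp add: d_def power2_eq_square mult.assoc)
  finally have "\<gamma> / 2 \<le> 2 powr (- (k * h)) * (2 * K\<^sup>2 / \<gamma>)" using dK by simp
  then have "2 powr (k * h) \<le> 4 * K\<^sup>2 * (1 / \<gamma>)\<^sup>2"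
    using \<gamma> by (simp add: powr_minus field_simps power2_eq_square)
  then have "log 2 (2 powr (k * h)) \<le> log 2 (4 * K\<^sup>2 * (1 / \<gamma>)\<^sup>2)"
    using \<gamma> K1 by (subst log_le_cancel_iff) auto
  also have "log 2 (4 * K\<^sup>2 * (1 / \<gamma>)\<^sup>2) = log 2 (2\<^sup>2) + log 2 (K\<^sup>2) + log 2 ((1 / \<gamma>)\<^sup>2)"
    using \<gamma> K1 by (simp add: log_mult)
  \<comment> \<open>The additive 4 of the bound is 2 from the factor \<open>4\<close> and 2 from the
    successor in \<open>Suc c\<close>.\<close>
  also have "\<dots> = 2 + 2 * real (Suc c) + 2 * log 2 (1 / \<gamma>)"
  proof -
    have "log 2 K = real (Suc c)" unfolding K_def by (simp add: log_nat_power del: power_Suc)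
    moreover have "log 2 ((2::real)\<^sup>2) = 2" by (subst log_nat_power) auto
    ultimately show ?thesis
      using \<gamma> K1 by (simp add: log_nat_power del: power_divide power_one_over)
  qed
  finally show ?thesis by (simp add: c_def)
qed

text \<open>Every inner node sends a bit, so zero communication forces a bare \<open>Output\<close>,
  to which the bound without losses applies.\<close>

lemma no_communication_lower_bound:
  assumes "communication \<mu> n R S P = 0"
  shows "k * h \<le> log 2 (1 / \<gamma>)"
proof (rule exponents)
  have "0 \<le> log 2 (1 / \<gamma>)" using \<gamma> by simp
  then show ?thesis if "h = 0" using that by simp
next
  fix p q
  assume pq: "1 \<le> p" "1 \<le> q" "1 \<le> 1 / p + 1 / q" and HC: "hypercontractive p q M"
    and eq: "(2 powr (- k)) powr (1 / p + 1 / q - 1) * real b powr (1 / q) = 2 powr (- (k * h))"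
  obtain u v where "(u, v) \<in> set_pmf M" using set_pmf_not_empty[of M] by fast
  then have "transcript P u v = []"
    using length_transcript_le_communication[of u v \<mu> n R S P] assms by simp
  then obtain f g where P: "P = Output f g" by (cases P) auto
  have "\<gamma> \<le> measure_pmf.prob M {(u, v). f u \<in> set (g v)}" using agreement by (simp add: P)
  also have "\<dots> \<le> (2 powr (- k)) powr (1 / p + 1 / q - 1) * real b powr (1 / q)"
    by (rule agreement_prob_le_no_communication[OF HC pq(2,3)])
      (use output_prob list_size b P in auto)
  finally have "\<gamma> \<le> 2 powr (- (k * h))" unfolding eq .
  then have "log 2 \<gamma> \<le> - (k * h)" using \<gamma> by (simp add: log_le_iff)
  then show ?thesis using \<gamma> by (simp add: log_divide)
qed

text \<open>The margin gives \<open>s\<^sup>2 - \<rho>\<^sup>2 \<ge> w * t\<close>. Since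
  \<open>s + \<rho> \<le> 2\<close>, this yields \<open>s - \<rho> \<ge> w * t / 2\<close> and
  \<open>h \<ge> w * t\<^sup>2 / 4\<close>; finally \<open>w \<ge> 2 * \<epsilon>\<close>.\<close>

lemma agreement_exponent_ge:
  assumes \<eta>: "0 < \<eta>" "log 2 (real b) / k \<le> 4 * \<epsilon> * (1 - \<epsilon>) / (1 + \<eta>)"
  shows "(\<eta> / (1 + \<eta>))\<^sup>2 / 2 * \<epsilon> \<le> h"
proof -
  define \<rho> where "\<rho> = 1 - 2 * \<epsilon>"
  define s where "s = sqrt (1 - log 2 (real b) / k)"
  define w where "w = 1 - \<rho>\<^sup>2"
  define t where "t = \<eta> / (1 + \<eta>)"
  have w: "w = 4 * \<epsilon> * (1 - \<epsilon>)" by (simp add: w_def \<rho>_def power2_eq_square algebra_simps)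
  have "\<epsilon> * (1/2) \<le> \<epsilon> * (1 - \<epsilon>)" using \<epsilon> by (intro mult_left_mono) auto
  then have w\<epsilon>: "2 * \<epsilon> \<le> w" unfolding w by simp
  have w0: "0 < w" using w\<epsilon> \<epsilon> by simp
  have t0: "0 < t" using \<eta> by (simp add: t_def)
  have \<rho>: "0 \<le> \<rho>" "\<rho> \<le> 1" using \<epsilon> by (auto simp: \<rho>_def)
  have "w / (1 + \<eta>) = w - w * t" using \<eta> by (simp add: t_def field_simps)
  then have gap: "\<rho>\<^sup>2 + w * t \<le> 1 - log 2 (real b) / k" using \<eta>(2) unfolding w[symmetric] by (simp add: w_def)
  have "0 \<le> \<rho>\<^sup>2 + w * t" using w0 t0 by simp
  then have s2: "s\<^sup>2 = 1 - log 2 (real b) / k" using gap by (simp add: s_def)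
  have s0: "0 \<le> s" using gap \<open>0 \<le> \<rho>\<^sup>2 + w * t\<close> by (simp add: s_def)
  have "log 2 (real b) / k \<ge> 0" using b k by simp
  then have s1: "s \<le> 1" by (simp add: s_def)
  have "\<rho>\<^sup>2 \<le> s\<^sup>2" using gap s2 w0 t0 by (smt (verit) mult_pos_pos)
  then have \<rho>s: "\<rho> \<le> s" using s0 by (rule power2_le_imp_le)
  have "w * t \<le> (s - \<rho>) * (s + \<rho>)" using gap s2 by (simp add: power2_eq_square algebra_simps)
  also have "\<dots> \<le> (s - \<rho>) * 2" using \<rho>s s1 \<rho> by (intro mult_left_mono) auto
  finally have "w * t / 2 \<le> s - \<rho>" by simp
  then have "(w * t / 2)\<^sup>2 \<le> (s - \<rho>)\<^sup>2" using w0 t0 by (intro power_mono) auto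
  then have "(w * t / 2)\<^sup>2 / w \<le> (s - \<rho>)\<^sup>2 / w" using w0 by (intro divide_right_mono) auto
  moreover have "(w * t / 2)\<^sup>2 / w = t\<^sup>2 / 4 * w" using w0 by (simp add: power2_eq_square)
  moreover have "t\<^sup>2 / 4 * (2 * \<epsilon>) \<le> t\<^sup>2 / 4 * w" using w\<epsilon> by (intro mult_left_mono) auto
  moreover have "h = (s - \<rho>)\<^sup>2 / w" by (simp add: agreement_exponent_def \<rho>_def s_def w_def)
  ultimately have "t\<^sup>2 / 4 * (2 * \<epsilon>) \<le> h" by linarith
  then show ?thesis by (simp add: t_def mult.commute)
qed

text \<open>Half of the previous bound on \<open>k * h\<close>; its term
  \<open>log 2 (1 / \<gamma>)\<close> is nonnegative and may be enlarged by the factor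
  \<open>3/2\<close>.\<close>

lemma communication_lower_bound_sqrt:
  "k * ((sqrt (1 - log 2 (real b) / k) - (1 - 2 * \<epsilon>))\<^sup>2 / (8 * \<epsilon> * (1 - \<epsilon>)))
     - 3/2 * log 2 (1 / \<gamma>) - 2 \<le> real (communication \<mu> n R S P)"
proof -
  have "8 * \<epsilon> * (1 - \<epsilon>) = 2 * (1 - (1 - 2 * \<epsilon>)\<^sup>2)"
    by (simp add: power2_eq_square algebra_simps)
  then have "(sqrt (1 - log 2 (real b) / k) - (1 - 2 * \<epsilon>))\<^sup>2 / (8 * \<epsilon> * (1 - \<epsilon>)) = h / 2"
    by (simp add: agreement_exponent_def)
  then have "k * ((sqrt (1 - log 2 (real b) / k) - (1 - 2 * \<epsilon>))\<^sup>2 / (8 * \<epsilon> * (1 - \<epsilon>))) = k * (h / 2)"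
    by (rule arg_cong)
  moreover have "k * (h / 2) = k * h / 2" by simp
  moreover have "0 \<le> log 2 (1 / \<gamma>)" using \<gamma> by simp
  ultimately show ?thesis using communication_lower_bound by linarith
qed

text \<open>Let \<open>x\<close> be the term linear in \<open>k\<close>, so that
  \<open>6 * x \<le> k * h\<close>. If \<open>c \<ge> 1\<close> bits are sent, then
  \<open>2 * c + 4 \<le> 6 * c\<close> absorbs the constant, which explains the 12; for
  \<open>c = 0\<close> the bound without communication suffices.\<close>

lemma communication_lower_bound_linear:
  assumes \<eta>: "0 < \<eta>" "log 2 (real b) / k \<le> 4 * \<epsilon> * (1 - \<epsilon>) / (1 + \<eta>)"
  shows "(\<eta> / (1 + \<eta>))\<^sup>2 / 12 * \<epsilon> * k - log 2 (1 / \<gamma>) \<le> real (communication \<mu> n R S P)"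
proof -
  have l: "0 \<le> log 2 (1 / \<gamma>)" using \<gamma> by simp
  have "k * ((\<eta> / (1 + \<eta>))\<^sup>2 / 2 * \<epsilon>) \<le> k * h"
    using k agreement_exponent_ge[OF \<eta>] by (intro mult_left_mono) auto
  moreover have "k * ((\<eta> / (1 + \<eta>))\<^sup>2 / 2 * \<epsilon>) = 6 * ((\<eta> / (1 + \<eta>))\<^sup>2 / 12 * \<epsilon> * k)" by simp
  ultimately have kh: "6 * ((\<eta> / (1 + \<eta>))\<^sup>2 / 12 * \<epsilon> * k) \<le> k * h" by linarith
  have x0: "0 \<le> (\<eta> / (1 + \<eta>))\<^sup>2 / 12 * \<epsilon> * k" using k \<epsilon> by simp
  show ?thesis
  proof (cases "communication \<mu> n R S P = 0")
    case True
    then show ?thesis using no_communication_lower_bound kh x0 by linarith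
  next
    case False
    then have "1 \<le> real (communication \<mu> n R S P)" by simp
    then show ?thesis using communication_lower_bound kh x0 l by linarith
  qed
qed

end

theorem theoremC7:
  shows
    "(\<exists>C::real. \<forall>(\<epsilon>::real) (k::real) (\<gamma>::real) (b::nat) (\<mu>::(int \<times> int) pmf) (n::nat)
        (R::nat pmf) (S::nat pmf) (P::(int list \<times> nat, int list \<times> nat, nat) protocol).
        0 < \<epsilon> \<and> \<epsilon> \<le> 1/2 \<and> 0 < k \<and> 1 \<le> b \<and> 0 < \<gamma> \<and> \<gamma> \<le> 1 \<and>
        log 2 (real b) / k \<le> 4 * \<epsilon> * (1 - \<epsilon>) \<and>
        is_DSBS (1 - 2 * \<epsilon>) \<mu> \<and>
        solves_list_common_randomness k \<gamma> b \<mu> n R S P \<longrightarrow>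
        real (communication \<mu> n R S P) \<ge>
          k * ((sqrt (1 - log 2 (real b) / k) - (1 - 2 * \<epsilon>))\<^sup>2 / (8 * \<epsilon> * (1 - \<epsilon>)))
            - 3/2 * log 2 (1 / \<gamma>) - C)
     \<and>
     (\<forall>\<eta>::real. 0 < \<eta> \<longrightarrow>
       (\<exists>c>0. \<exists>C::real. \<forall>(\<epsilon>::real) (k::real) (\<gamma>::real) (b::nat) (\<mu>::(int \<times> int) pmf) (n::nat)
          (R::nat pmf) (S::nat pmf) (P::(int list \<times> nat, int list \<times> nat, nat) protocol).
          0 < \<epsilon> \<and> \<epsilon> \<le> 1/2 \<and> 0 < k \<and> 1 \<le> b \<and> 0 < \<gamma> \<and> \<gamma> \<le> 1 \<and>
          log 2 (real b) / k \<le> 4 * \<epsilon> * (1 - \<epsilon>) / (1 + \<eta>) \<and>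
          is_DSBS (1 - 2 * \<epsilon>) \<mu> \<and>
          solves_list_common_randomness k \<gamma> b \<mu> n R S P \<longrightarrow>
          real (communication \<mu> n R S P) \<ge> c * \<epsilon> * k - C * log 2 (1 / \<gamma>)))"
proof (intro conjI allI impI)
  show "\<exists>C::real. \<forall>(\<epsilon>::real) (k::real) (\<gamma>::real) (b::nat) (\<mu>::(int \<times> int) pmf) (n::nat)
        (R::nat pmf) (S::nat pmf) (P::(int list \<times> nat, int list \<times> nat, nat) protocol).
        0 < \<epsilon> \<and> \<epsilon> \<le> 1/2 \<and> 0 < k \<and> 1 \<le> b \<and> 0 < \<gamma> \<and> \<gamma> \<le> 1 \<and>
        log 2 (real b) / k \<le> 4 * \<epsilon> * (1 - \<epsilon>) \<and>
        is_DSBS (1 - 2 * \<epsilon>) \<mu> \<and>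
        solves_list_common_randomness k \<gamma> b \<mu> n R S P \<longrightarrow>
        real (communication \<mu> n R S P) \<ge>
          k * ((sqrt (1 - log 2 (real b) / k) - (1 - 2 * \<epsilon>))\<^sup>2 / (8 * \<epsilon> * (1 - \<epsilon>)))
            - 3/2 * log 2 (1 / \<gamma>) - C"
    by (rule exI[of _ 2], intro allI impI, elim conjE, rule communication_lower_bound_sqrt)
next
  fix \<eta> :: real assume \<eta>: "0 < \<eta>"
  have rate: "log 2 (real b) / k \<le> 4 * \<epsilon> * (1 - \<epsilon>)"
    if "0 < \<epsilon>" "\<epsilon> \<le> 1/2" "log 2 (real b) / k \<le> 4 * \<epsilon> * (1 - \<epsilon>) / (1 + \<eta>)" for b k \<epsilon>
  proof -
    have "4 * \<epsilon> * (1 - \<epsilon>) / (1 + \<eta>) \<le> 4 * \<epsilon> * (1 - \<epsilon>) / 1"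
      using that \<eta> by (intro divide_left_mono) auto
    then show ?thesis using that by simp
  qed
  have bound: "(\<eta> / (1 + \<eta>))\<^sup>2 / 12 * \<epsilon> * k - 1 * log 2 (1 / \<gamma>) \<le> real (communication \<mu> n R S P)"
    if "0 < \<epsilon>" "\<epsilon> \<le> 1/2" "0 < k" "1 \<le> b" "0 < \<gamma>" "\<gamma> \<le> 1"
      "log 2 (real b) / k \<le> 4 * \<epsilon> * (1 - \<epsilon>) / (1 + \<eta>)"
      "is_DSBS (1 - 2 * \<epsilon>) \<mu>" "solves_list_common_randomness k \<gamma> b \<mu> n R S P"
    for \<epsilon> k \<gamma> b \<mu> n R S and P :: "(int list \<times> nat, int list \<times> nat, nat) protocol"
    using communication_lower_bound_linear[OF that(1-6) rate[OF that(1,2,7)] that(8,9) \<eta> that(7)] by simp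
  show "\<exists>c>0. \<exists>C::real. \<forall>(\<epsilon>::real) (k::real) (\<gamma>::real) (b::nat) (\<mu>::(int \<times> int) pmf) (n::nat)
          (R::nat pmf) (S::nat pmf) (P::(int list \<times> nat, int list \<times> nat, nat) protocol).
          0 < \<epsilon> \<and> \<epsilon> \<le> 1/2 \<and> 0 < k \<and> 1 \<le> b \<and> 0 < \<gamma> \<and> \<gamma> \<le> 1 \<and>
          log 2 (real b) / k \<le> 4 * \<epsilon> * (1 - \<epsilon>) / (1 + \<eta>) \<and>
          is_DSBS (1 - 2 * \<epsilon>) \<mu> \<and>
          solves_list_common_randomness k \<gamma> b \<mu> n R S P \<longrightarrow>
          real (communication \<mu> n R S P) \<ge> c * \<epsilon> * k - C * log 2 (1 / \<gamma>)"
    by (rule exI[of _ "(\<eta> / (1 + \<eta>))\<^sup>2 / 12"], rule conjI, use \<eta> in simp, rule exI[of _ 1],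
        intro allI impI, elim conjE, rule bound)
qed

end
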